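(* Let $G$ be a simply connected abelian real Lie group (with trivial compact factor) of dimension $n\ge 1$, with a discrete cocompact subgroup $\Gamma$. Then \[ \mathfrak T_\Gamma(G)=\int_{[0,1]^n} T(\Gamma\backslash G,\alpha)\,d\alpha , \] where $\mathfrak T_\Gamma(G)$ is the relative analytic torsion of the pair $(G,\Gamma)$ and $T(\Gamma\backslash G,\alpha)$ is the analytic torsion of the compact quotient $\Gamma\backslash G$ with coefficients twisted by the character $\chi_\alpha$ of $\Gamma=\pi_1(\Gamma\backslash G)$.
   Context: $G\cong\mathbb R^n$ with a translation invariant (flat) metric and $\Gamma\backslash G$ carries the quotient metric. $\hat G\cong\mathbb R^n$ via the characters $\chi_h(g)=e^{2\pi i\langle h,g\rangle}$, with Plancherel measure $\mu$ the Lebesgue measure $dh$. $\Delta^{(q)}$ is the self adjoint Hodge Laplace operator on square integrable $q$-forms on $G$; its localisation $\Delta^{(q)}(h)=d\chi_h(\Delta^{(q)})$ on $\Lambda^q(\mathbb R^n)^*\otimes\mathbb C$ is multiplication by $4\pi^2|h|^2$ (representations in the null set $\{h=0\}$ are ignored). Put $\zeta(s,\Delta^{(q)}(h))=\sum_{\lambda\in\mathrm{Sp}_+\Delta^{(q)}(h)}\lambda^{-s}$ (positive eigenvalues with multiplicity), \[ \mathfrak t(s;G,h)=\sum_{q=0}^n(-1)^q q\,\zeta(s,\Delta^{(q)}(h)),\qquad \mathfrak T(G;h)=\frac{d}{ds}\mathfrak t(s;G,h)\Big|_{s=0}. \] For a fixed $K>0$ let $\hat G_0\subseteq\hat G$ be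 the set of $h$ such that the condition "there is $K_h>K$ with $\mathrm{Sp}\,\Delta^{(q)}(h)>K_h$ for all $q$" fails. The relative analytic torsion is \[ \mathfrak{T}_\Gamma(G)=\frac{d}{ds}\int_{\hat G-\hat G_0}\mathfrak t(s;G,h)\,d\mu(h)\Big|_{s=0}+\int_{\hat G_0}\mathfrak T(G;h)\,d\mu(h), \] where the first integral is defined for large $\mathrm{Re}(s)$ and continued analytically to $s=0$. Choose an isomorphism $\Gamma\cong\mathbb Z^n$; its irreducible unitary representations are the characters $\chi_\alpha(\nu)=e^{2\pi i\langle\alpha,\nu\rangle}$, $\alpha\in[0,1)^n$. For $\alpha\neq0$, let $\Delta^{(q)}_\alpha$ be the Hodge Laplace operator on $q$-forms on $\Gamma\backslash G$ with values in the flat line bundle associated to $\chi_\alpha$, and $\zeta(s,\Delta_\alpha^{(q)})=\sum_{0\ne\lambda\in\mathrm{Sp}\Delta_\alpha^{(q)}}\lambda^{-s}$ (with multiplicity, continued analytically). Then \[ T(\Gamma\backslash G,\alpha)=\frac{d}{ds}\sum_{q=0}^{n}(-1)^q q\,\zeta(s,\Delta^{(q)}_\alpha)\Big|_{s=0} \] (normalised without a factor $\tfrac12$). For example, for $G=\mathbb R$, $\Gamma=\mathbb Z$, $\mathrm{Sp}\,\Delta_\alpha^{(1)}=\{4\pi^2(\nu+\alpha)^2\}_{\nu\in\mathbb Z}$. *)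

theory Defs
  imports "HOL-Complex_Analysis.Complex_Analysis" "HOL-Library.Function_Algebras"
begin

text \<open>
  The group \<open>G\<close> with its flat metric is a Euclidean space \<^typ>\<open>'a::euclidean_space\<close>, the metric being
  the inner product; \<open>n = DIM('a) \<ge> 1\<close>.  The dual group is again \<^typ>\<open>'a\<close>, with \<open>h\<close> standing for the
  character \<open>\<chi>\<^sub>h\<close>, and the Plancherel measure is \<^const>\<open>lborel\<close>.
\<close>

section \<open>Discrete cocompact subgroups\<close>

text \<open>The quotient topology on the set of cosets of \<open>\<Gamma>\<close>.\<close>

definition coset_topology :: "'a::euclidean_space set \<Rightarrow> 'a set topology" where
  "coset_topology \<Gamma> =
     topology (\<lambda>U. U \<subseteq> range (\<lambda>x. (+) x ` \<Gamma>) \<and> open ((\<lambda>x. (+) x ` \<Gamma>) -` U))"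

lemma istopology_coset:
  "istopology (\<lambda>U. U \<subseteq> range (\<lambda>x. (+) x ` \<Gamma>) \<and> open ((\<lambda>x. (+) x ` \<Gamma>) -` U))"
  for \<Gamma> :: "'a::euclidean_space set"
  unfolding istopology_def by (auto simp: vimage_Union)

definition discrete_cocompact_subgroup :: "'a::euclidean_space set \<Rightarrow> bool" where
  "discrete_cocompact_subgroup \<Gamma> \<longleftrightarrow>
     0 \<in> \<Gamma> \<and> (\<forall>x\<in>\<Gamma>. \<forall>y\<in>\<Gamma>. x + y \<in> \<Gamma>) \<and> (\<forall>x\<in>\<Gamma>. - x \<in> \<Gamma>) \<and>
     discrete \<Gamma> \<and> compact_space (coset_topology \<Gamma>)"

section \<open>Differential forms and the Hodge Laplacian\<close>

text \<open>
  A complex \<open>q\<close>-covector is an alternating real-multilinear function of \<open>q\<close> vectors, encoded as a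
  function on lists which vanishes on lists of length different from \<open>q\<close>.
\<close>

type_synonym 'a covector = "'a list \<Rightarrow> complex"
type_synonym 'a form = "'a \<Rightarrow> 'a covector"

definition covectors :: "nat \<Rightarrow> 'a::euclidean_space covector set" where
  "covectors q = {\<eta>.
     (\<forall>vs. length vs \<noteq> q \<longrightarrow> \<eta> vs = 0) \<and>
     (\<forall>vs i. length vs = q \<and> i < q \<longrightarrow> linear (\<lambda>v. \<eta> (vs[i := v]))) \<and>
     (\<forall>vs i j. length vs = q \<and> i < j \<and> j < q \<and> vs ! i = vs ! j \<longrightarrow> \<eta> vs = 0)}"

definition covector_scale :: "complex \<Rightarrow> 'a covector \<Rightarrow> 'a covector" where
  "covector_scale c \<eta> = (\<lambda>vs. c * \<eta> vs)"

definition form_scale :: "complex \<Rightarrow> 'a form \<Rightarrow> 'a form" where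
  "form_scale c \<omega> = (\<lambda>x vs. c * \<omega> x vs)"

lemma vector_space_covector_scale: "vector_space covector_scale"
  by unfold_locales (auto simp: covector_scale_def fun_eq_iff algebra_simps)

lemma vector_space_form_scale: "vector_space form_scale"
  by unfold_locales (auto simp: form_scale_def fun_eq_iff algebra_simps)

definition dir_deriv :: "'a::euclidean_space \<Rightarrow> ('a \<Rightarrow> complex) \<Rightarrow> 'a \<Rightarrow> complex" where
  "dir_deriv v f x = frechet_derivative f (at x) v"

text \<open>\<open>C\<^sup>\<infinity>\<close>: all iterated directional derivatives exist and are (Frechet) differentiable.\<close>

definition smooth :: "('a::euclidean_space \<Rightarrow> complex) \<Rightarrow> bool" where
  "smooth f \<longleftrightarrow> (\<forall>vs x. foldr dir_deriv vs f differentiable (at x))"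

definition smooth_forms :: "nat \<Rightarrow> 'a::euclidean_space form set" where
  "smooth_forms q = {\<omega>. (\<forall>x. \<omega> x \<in> covectors q) \<and> (\<forall>vs. smooth (\<lambda>x. \<omega> x vs))}"

text \<open>
  \<open>(d\<omega>)(v\<^sub>0, \<dots>, v\<^sub>q) = \<Sum>\<^sub>i (-1)\<^sup>i \<partial>\<^bsub>v\<^sub>i\<^esub> (\<omega>(v\<^sub>0, \<dots>, v\<^sub>i omitted, \<dots>, v\<^sub>q))\<close> for constant vector fields \<open>v\<^sub>i\<close>.
\<close>

definition ext_deriv :: "'a::euclidean_space form \<Rightarrow> 'a form" where
  "ext_deriv \<omega> = (\<lambda>x vs. \<Sum>i<length vs.
     (- 1) ^ i * dir_deriv (vs ! i) (\<lambda>y. \<omega> y (take i vs @ drop (Suc i) vs)) x)"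

text \<open>
  The formal adjoint of \<^const>\<open>ext_deriv\<close>: for the flat metric it is \<open>\<delta> = - \<Sum>\<^sub>b \<iota>\<^sub>b \<nabla>\<^sub>b\<close>, the sum over an
  orthonormal basis.
\<close>

definition codiff :: "'a::euclidean_space form \<Rightarrow> 'a form" where
  "codiff \<omega> = (\<lambda>x vs. - (\<Sum>b\<in>Basis. dir_deriv b (\<lambda>y. \<omega> y (b # vs)) x))"

definition hodge_laplacian :: "'a::euclidean_space form \<Rightarrow> 'a form" where
  "hodge_laplacian \<omega> = ext_deriv (codiff \<omega>) + codiff (ext_deriv \<omega>)"

section \<open>Spectra and zeta functions\<close>

text \<open>
  Point spectrum of an operator \<open>D\<close> on a complex vector space \<open>V\<close> with scalar multiplication \<open>smul\<close>.
  The operators below are symmetric, so that only real eigenvalues occur.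
\<close>

definition eigenspace ::
  "(complex \<Rightarrow> 'b \<Rightarrow> 'b) \<Rightarrow> 'b::ab_group_add set \<Rightarrow> ('b \<Rightarrow> 'b) \<Rightarrow> real \<Rightarrow> 'b set" where
  "eigenspace smul V D \<mu> = {v \<in> V. D v = smul (complex_of_real \<mu>) v}"

definition spectrum ::
  "(complex \<Rightarrow> 'b \<Rightarrow> 'b) \<Rightarrow> 'b::ab_group_add set \<Rightarrow> ('b \<Rightarrow> 'b) \<Rightarrow> real set" where
  "spectrum smul V D = {\<mu>. \<exists>v \<in> eigenspace smul V D \<mu>. v \<noteq> 0}"

definition eigen_multiplicity ::
  "(complex \<Rightarrow> 'b \<Rightarrow> 'b) \<Rightarrow> 'b::ab_group_add set \<Rightarrow> ('b \<Rightarrow> 'b) \<Rightarrow> real \<Rightarrow> nat" where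
  "eigen_multiplicity smul V D \<mu> = vector_space.dim smul (eigenspace smul V D \<mu>)"

text \<open>
  A continuation of \<open>F\<close>, given on some half plane \<open>Re s > a\<close>, to \<open>s = 0\<close>: meromorphic on
  \<open>Re s \<ge> 0\<close> and analytic at \<open>0\<close>.  By the identity theorem all such \<open>g\<close> agree near \<open>0\<close>, so that
  the derivatives at \<open>0\<close> used below do not depend on the choice.
\<close>

definition is_continuation :: "(complex \<Rightarrow> complex) \<Rightarrow> (complex \<Rightarrow> complex) \<Rightarrow> bool" where
  "is_continuation F g \<longleftrightarrow>
     g meromorphic_on {s. Re s \<ge> 0} \<and> g analytic_on {0} \<and>
     (\<exists>a::real. \<forall>s. Re s > a \<longrightarrow> g s = F s)"

definition continuation :: "(complex \<Rightarrow> complex) \<Rightarrow> complex \<Rightarrow> complex" where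
  "continuation F = (if \<exists>g. is_continuation F g then SOME g. is_continuation F g else (\<lambda>_. 0))"

section \<open>Relative analytic torsion\<close>

definition char_G :: "'a::euclidean_space \<Rightarrow> 'a \<Rightarrow> complex" where
  "char_G h g = exp (2 * of_real pi * \<i> * of_real (h \<bullet> g))"

text \<open>
  \<open>d\<chi>\<^sub>h(D)\<eta> = D(\<chi>\<^sub>h \<eta>)(0)\<close> for an invariant differential operator \<open>D\<close>, since
  \<open>d\<chi>\<^sub>h(X) = X\<chi>\<^sub>h(0)\<close> for an invariant vector field \<open>X\<close>.
\<close>

definition localised_laplacian :: "'a::euclidean_space \<Rightarrow> 'a covector \<Rightarrow> 'a covector" where
  "localised_laplacian h \<eta> = hodge_laplacian (\<lambda>g. covector_scale (char_G h g) \<eta>) 0"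

definition local_spectrum :: "nat \<Rightarrow> 'a::euclidean_space \<Rightarrow> real set" where
  "local_spectrum q h = spectrum covector_scale (covectors q) (localised_laplacian h)"

definition local_zeta :: "nat \<Rightarrow> 'a::euclidean_space \<Rightarrow> complex \<Rightarrow> complex" where
  "local_zeta q h s = (\<Sum>\<^sub>\<infinity>\<mu>\<in>{\<mu>\<in>local_spectrum q h. \<mu> > 0}.
     of_nat (eigen_multiplicity covector_scale (covectors q) (localised_laplacian h) \<mu>)
       * complex_of_real \<mu> powr (- s))"

definition local_t :: "complex \<Rightarrow> 'a::euclidean_space \<Rightarrow> complex" where
  "local_t s h = (\<Sum>q\<le>DIM('a). (- 1) ^ q * of_nat q * local_zeta q h s)"

definition local_torsion :: "'a::euclidean_space \<Rightarrow> complex" where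
  "local_torsion h = deriv (\<lambda>s. local_t s h) 0"

definition dual_G0 :: "real \<Rightarrow> 'a::euclidean_space set" where
  "dual_G0 K = {h. \<not> (\<exists>K\<^sub>h>K. \<forall>q\<le>DIM('a). \<forall>\<mu>\<in>local_spectrum q h. \<mu> > K\<^sub>h)}"

text \<open>The subgroup \<open>\<Gamma>\<close> does not occur in the definition of \<open>\<TT>\<^sub>\<Gamma>(G)\<close>.\<close>

definition relative_torsion :: "'a::euclidean_space itself \<Rightarrow> real \<Rightarrow> complex" where
  "relative_torsion _ K =
     deriv (continuation (\<lambda>s. LINT h:(UNIV - dual_G0 K :: 'a set)|lborel. local_t s h)) 0
     + (LINT h:(dual_G0 K :: 'a set)|lborel. local_torsion h)"

section \<open>Twisted analytic torsion of the quotient\<close>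

text \<open>Here \<open>\<phi>\<close> is the chosen isomorphism from \<open>\<Gamma>\<close> to \<open>\<int>\<^sup>n\<close>.\<close>

definition char_\<Gamma> :: "('a \<Rightarrow> int ^ 'n) \<Rightarrow> real ^ 'n \<Rightarrow> 'a \<Rightarrow> complex" where
  "char_\<Gamma> \<phi> \<alpha> \<gamma> = exp (2 * of_real pi * \<i> * of_real (\<Sum>i\<in>UNIV. \<alpha> $ i * of_int (\<phi> \<gamma> $ i)))"

text \<open>
  Smooth \<open>q\<close>-forms on the quotient with values in the flat line bundle associated to \<open>\<chi>\<^sub>\<alpha>\<close>, as
  equivariant forms on the universal covering \<open>G\<close>.
\<close>

definition twisted_forms ::
  "'a::euclidean_space set \<Rightarrow> ('a \<Rightarrow> int ^ 'n) \<Rightarrow> real ^ 'n \<Rightarrow> nat \<Rightarrow> 'a form set" where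
  "twisted_forms \<Gamma> \<phi> \<alpha> q =
     {\<omega> \<in> smooth_forms q. \<forall>\<gamma>\<in>\<Gamma>. \<forall>x. \<omega> (\<gamma> + x) = covector_scale (char_\<Gamma> \<phi> \<alpha> \<gamma>) (\<omega> x)}"

definition twisted_spectrum ::
  "'a::euclidean_space set \<Rightarrow> ('a \<Rightarrow> int ^ 'n) \<Rightarrow> real ^ 'n \<Rightarrow> nat \<Rightarrow> real set" where
  "twisted_spectrum \<Gamma> \<phi> \<alpha> q = spectrum form_scale (twisted_forms \<Gamma> \<phi> \<alpha> q) hodge_laplacian"

definition twisted_zeta ::
  "'a::euclidean_space set \<Rightarrow> ('a \<Rightarrow> int ^ 'n) \<Rightarrow> real ^ 'n \<Rightarrow> nat \<Rightarrow> complex \<Rightarrow> complex" where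
  "twisted_zeta \<Gamma> \<phi> \<alpha> q s = (\<Sum>\<^sub>\<infinity>\<mu>\<in>twisted_spectrum \<Gamma> \<phi> \<alpha> q - {0}.
     of_nat (eigen_multiplicity form_scale (twisted_forms \<Gamma> \<phi> \<alpha> q) hodge_laplacian \<mu>)
       * complex_of_real \<mu> powr (- s))"

definition analytic_torsion ::
  "'a::euclidean_space set \<Rightarrow> ('a \<Rightarrow> int ^ 'n) \<Rightarrow> real ^ 'n \<Rightarrow> complex" where
  "analytic_torsion \<Gamma> \<phi> \<alpha> =
     deriv (\<lambda>s. \<Sum>q\<le>DIM('a). (- 1) ^ q * of_nat q * continuation (twisted_zeta \<Gamma> \<phi> \<alpha> q) s) 0"

end

theory Submission
  imports Defs
begin

text \<open>
  The metric is flat, so the Hodge Laplacian differentiates the coefficients of a form and leaves its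
  covector part alone (\<open>hodge_laplacian_eq_scalar_laplacian\<close>).  An eigenspace on \<open>q\<close>-forms, localised or
  twisted, is therefore the space of eigenfunctions tensored with the \<open>q\<close>-covectors; its dimension is
  \<open>n choose q\<close> times that for functions (\<open>dim_covectors\<close>, \<open>dim_forms_with_coeffs\<close>).  Consequently every zeta
  function in degree \<open>q\<close> is \<open>n choose q\<close> times the one in degree \<open>0\<close>, and the alternating sums that define
  the torsions carry the factor \<open>\<Sum>\<^sub>q (-1)\<^sup>q q (n choose q)\<close>, which is \<open>-1\<close> for \<open>n = 1\<close> and \<open>0\<close> otherwise
  (\<open>degree_weight\<close>).  For \<open>n \<noteq> 1\<close> both sides of the identity vanish identically.

  For \<open>n = 1\<close> both sides are \<open>0\<close> as well, by computation.  Put \<open>K = 4\<pi>\<^sup>2r\<^sup>2\<close>.  On the left,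
  \<open>- \<integral> (4\<pi>\<^sup>2x\<^sup>2)\<^sup>-\<^sup>s dx\<close> over \<open>\<bar>x\<bar> > r\<close> continues to \<open>- 2r (4\<pi>\<^sup>2r\<^sup>2)\<^sup>-\<^sup>s / (2s - 1)\<close>, and its derivative at \<open>0\<close>
  is the negative of \<open>\<integral> ln (4\<pi>\<^sup>2x\<^sup>2) dx\<close> over \<open>\<bar>x\<bar> \<le> r\<close> (\<open>relative_torsion_eq_0\<close>).

  On the right, \<open>\<Gamma>\<close> is generated by a single vector of length \<open>l\<close>, and outside the null set \<open>2\<alpha> \<in> \<int>\<close>
  the eigenvalues \<open>4\<pi>\<^sup>2(\<nu> + \<alpha>)\<^sup>2/l\<^sup>2\<close>, \<open>\<nu> \<in> \<int>\<close>, are simple, so that the zeta function is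
  \<open>(4\<pi>\<^sup>2/l\<^sup>2)\<^sup>-\<^sup>s Z(2s)\<close> with \<open>Z(w) = \<Sum>\<^sub>\<nu> \<bar>\<nu> + \<alpha>\<bar>\<^sup>-\<^sup>w\<close>.  Comparing \<open>(n + \<alpha>)\<^sup>-\<^sup>w + (n - \<alpha>)\<^sup>-\<^sup>w\<close> with \<open>2n\<^sup>-\<^sup>w\<close>
  leaves second differences, whose sum converges beyond \<open>Re w = 0\<close> and whose derivative at \<open>0\<close> is minus the
  logarithm of Euler's sine product; the case \<open>\<alpha> = 1/2\<close> of the same sum continues \<open>\<Sum>\<^sub>n n\<^sup>-\<^sup>w\<close>.  This gives
  \<open>Z(0) = 0\<close>, which removes the dependence on \<open>l\<close>, and \<open>Z'(0) = - ln (2 sin \<pi>\<alpha>)\<close>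
  (\<open>lattice_zeta_has_derivative_0\<close>).  Hence the torsion of the circle is \<open>2 ln (2 sin \<pi>\<alpha>)\<close>
  (\<open>analytic_torsion_circle\<close>), and its integral over \<open>[0, 1]\<close> is \<open>0\<close> because the duplication formula of
  the sine shows that the integral equals its own half (\<open>log_sine_integral\<close>).
\<close>

section \<open>Smooth functions and the symmetry of second derivatives\<close>

lemma smooth_differentiable: "smooth f \<Longrightarrow> f differentiable (at x)"
  unfolding smooth_def by (metis foldr_Nil id_apply)

lemma smooth_dir_deriv: 
  assumes "smooth f" shows "smooth (dir_deriv v f)"
  unfolding smooth_def
proof (intro allI)
  fix vs x
  have "foldr dir_deriv (vs @ [v]) f differentiable (at x)" using assms unfolding smooth_def by blast
  then show "foldr dir_deriv vs (dir_deriv v f) differentiable (at x)" by simp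
qed

lemma has_derivative_dir_deriv:
  "f differentiable (at x) \<Longrightarrow> (f has_derivative (\<lambda>v. dir_deriv v f x)) (at x)"
  unfolding dir_deriv_def using frechet_derivative_works by blast

lemma dir_deriv_eqI: "(f has_derivative f') (at x) \<Longrightarrow> dir_deriv v f x = f' v"
  unfolding dir_deriv_def by (metis frechet_derivative_at)

lemma dir_deriv_const [simp]: "dir_deriv v (\<lambda>_. c) = (\<lambda>_. 0)"
  by (rule ext, rule dir_deriv_eqI[where f'="\<lambda>_. 0"]) simp

lemma dir_deriv_add:
  assumes "\<And>x. f differentiable (at x)" "\<And>x. g differentiable (at x)"
  shows "dir_deriv v (\<lambda>x. f x + g x) = (\<lambda>x. dir_deriv v f x + dir_deriv v g x)"
  by (rule ext, rule dir_deriv_eqI) 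
    (intro has_derivative_add has_derivative_dir_deriv assms)

lemma dir_deriv_cmult:
  assumes "\<And>x. f differentiable (at x)"
  shows "dir_deriv v (\<lambda>x. c * f x) = (\<lambda>x. c * dir_deriv v f x)"
  by (rule ext, rule dir_deriv_eqI)
    (intro has_derivative_mult_right has_derivative_dir_deriv assms)

lemma dir_deriv_uminus:
  assumes "\<And>x. f differentiable (at x)"
  shows "dir_deriv v (\<lambda>x. - f x) = (\<lambda>x. - dir_deriv v f x)"
  using dir_deriv_cmult[OF assms, of v "-1"] by simp

lemma dir_deriv_sum:
  assumes "\<And>i x. i \<in> I \<Longrightarrow> f i differentiable (at x)"
  shows "dir_deriv v (\<lambda>x. \<Sum>i\<in>I. f i x) = (\<lambda>x. \<Sum>i\<in>I. dir_deriv v (f i) x)"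
  by (rule ext, rule dir_deriv_eqI)
    (intro has_derivative_sum has_derivative_dir_deriv assms)

lemma smooth_const: "smooth (\<lambda>_. c)"
proof -
  have "\<exists>c. foldr dir_deriv vs (\<lambda>_. k) = (\<lambda>_. c)" for vs :: "'a list" and k
    by (induction vs) auto
  then show ?thesis unfolding smooth_def by (metis differentiable_const)
qed

lemma smooth_add: 
  assumes "smooth f" "smooth g" shows "smooth (\<lambda>x. f x + g x)"
proof -
  have "foldr dir_deriv vs (\<lambda>x. f x + g x) = (\<lambda>x. foldr dir_deriv vs f x + foldr dir_deriv vs g x)" for vs
    using assms by (induction vs) (auto simp: smooth_def dir_deriv_add)
  then show ?thesis using assms by (auto simp: smooth_def intro!: derivative_intros)
qed

lemma smooth_cmult:
  assumes "smooth f" shows "smooth (\<lambda>x. c * f x)"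
proof -
  have "foldr dir_deriv vs (\<lambda>x. c * f x) = (\<lambda>x. c * foldr dir_deriv vs f x)" for vs
    using assms by (induction vs) (auto simp: smooth_def dir_deriv_cmult)
  then show ?thesis using assms by (auto simp: smooth_def intro!: derivative_intros)
qed

lemma smooth_char_G: "smooth (char_G h)"
  and dir_deriv_char_G: "dir_deriv v (char_G h) = (\<lambda>x. 2 * of_real pi * \<i> * of_real (h \<bullet> v) * char_G h x)"
proof -
  have d: "(char_G h has_derivative (\<lambda>v. 2 * of_real pi * \<i> * of_real (h \<bullet> v) * char_G h x)) (at x)" for x
  proof -
    have "((\<lambda>g. 2 * of_real pi * \<i> * complex_of_real (h \<bullet> g)) has_derivative
        (\<lambda>v. 2 * of_real pi * \<i> * complex_of_real (h \<bullet> v))) (at x)"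
      by (intro has_derivative_mult_right has_derivative_of_real has_derivative_inner_right has_derivative_ident)
    from has_derivative_compose[OF this DERIV_exp[unfolded has_field_derivative_def]]
    show ?thesis by (simp add: char_G_def[abs_def] mult.commute)
  qed
  show dd: "dir_deriv v (char_G h) = (\<lambda>x. 2 * of_real pi * \<i> * of_real (h \<bullet> v) * char_G h x)" for v
    by (rule ext, rule dir_deriv_eqI[OF d])
  have diff: "char_G h differentiable (at x)" for x
    using d differentiable_def by blast
  have "\<exists>c. foldr dir_deriv vs (char_G h) = (\<lambda>x. c * char_G h x)" for vs
  proof (induction vs)
    case Nil
    show ?case by (auto intro!: exI[of _ 1])
  next
    case (Cons v vs)
    then obtain c where "foldr dir_deriv vs (char_G h) = (\<lambda>x. c * char_G h x)" by blast
    then have "foldr dir_deriv (v # vs) (char_G h) = (\<lambda>x. (c * (2 * of_real pi * \<i> * of_real (h \<bullet> v))) * char_G h x)"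
      by (simp add: dir_deriv_cmult[OF diff] dd mult.assoc)
    then show ?case by blast
  qed
  moreover have "(\<lambda>x. c * char_G h x) differentiable (at x)" for c x
    by (intro differentiable_mult differentiable_const diff)
  ultimately show "smooth (char_G h)" unfolding smooth_def by metis
qed

text \<open>
  The second difference of \<open>f\<close> over the parallelogram spanned by \<open>a\<close> and \<open>b\<close> is an intermediate
  value of either mixed derivative; by continuity the two mixed derivatives agree.
\<close>

lemma second_difference_mean_value:
  fixes f :: "'a::euclidean_space \<Rightarrow> real"
  assumes f: "\<And>y. (f has_derivative (\<lambda>v. Df v y)) (at y)"
    and Df: "\<And>y. (Df a has_derivative (\<lambda>v. D2f v y)) (at y)"
    and h: "h > 0"
  shows "\<exists>s t. 0 < s \<and> s < h \<and> 0 < t \<and> t < h \<and>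
    f (x + h *\<^sub>R a + h *\<^sub>R b) - f (x + h *\<^sub>R a) - f (x + h *\<^sub>R b) + f x = h * h * D2f b (x + s *\<^sub>R a + t *\<^sub>R b)"
proof -
  have line: "((\<lambda>u. F (y + u *\<^sub>R v)) has_real_derivative F' v (y + u *\<^sub>R v)) (at u)"
    if "\<And>y. (F has_derivative (\<lambda>v. F' v y)) (at y)" for F :: "'a \<Rightarrow> real" and F' y u v
  proof -
    have "((\<lambda>u. F (y + u *\<^sub>R v)) has_derivative (\<lambda>k. F' (k *\<^sub>R v) (y + u *\<^sub>R v))) (at u)"
      by (rule has_derivative_compose[OF _ that]) (auto intro!: derivative_eq_intros)
    moreover have "F' (k *\<^sub>R v) z = F' v z * k" for k z
      using linear_scale[OF has_derivative_linear[OF that]] by simp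
    ultimately show ?thesis by (simp add: has_field_derivative_def)
  qed
  define g where "g u = f (x + h *\<^sub>R b + u *\<^sub>R a) - f (x + u *\<^sub>R a)" for u
  have "(g has_real_derivative Df a (x + h *\<^sub>R b + u *\<^sub>R a) - Df a (x + u *\<^sub>R a)) (at u)" for u
    unfolding g_def by (intro DERIV_diff line f)
  from MVT2[OF h this] obtain s where s: "0 < s" "s < h"
    "g h - g 0 = h * (Df a (x + h *\<^sub>R b + s *\<^sub>R a) - Df a (x + s *\<^sub>R a))" by auto
  have "((\<lambda>u. Df a (x + s *\<^sub>R a + u *\<^sub>R b)) has_real_derivative D2f b (x + s *\<^sub>R a + u *\<^sub>R b)) (at u)" for u
    by (rule line[OF Df])
  from MVT2[OF h this] obtain t where t: "0 < t" "t < h"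
    "Df a (x + s *\<^sub>R a + h *\<^sub>R b) - Df a (x + s *\<^sub>R a) = h * D2f b (x + s *\<^sub>R a + t *\<^sub>R b)" by auto
  show ?thesis
    using s t by (intro exI[of _ s] exI[of _ t]) (simp add: g_def algebra_simps)
qed

lemma real_mixed_derivatives_commute:
  fixes f :: "'a::euclidean_space \<Rightarrow> real"
  assumes f: "\<And>y. (f has_derivative (\<lambda>v. Df v y)) (at y)"
    and Df: "\<And>v y. (Df v has_derivative (\<lambda>w. D2f w v y)) (at y)"
    and cont: "\<And>v w. continuous_on UNIV (D2f w v)"
  shows "D2f b a x = D2f a b x"
proof -
  have le: "\<not> D2f b a x < D2f a b x" for a b
  proof
    assume "D2f b a x < D2f a b x"
    then obtain m where m: "D2f b a x < m" "m < D2f a b x" using dense by blast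
    have "\<forall>\<^sub>F y in nhds x. D2f b a y < m \<and> m < D2f a b y"
      using m cont by (intro eventually_conj order_tendstoD[of "D2f _ _"])
        (auto simp: continuous_on_eq_continuous_within continuous_within tendsto_nhds_iff isCont_def)
    then obtain d where d: "d > 0" "\<And>y. dist y x < d \<Longrightarrow> D2f b a y < m \<and> m < D2f a b y"
      unfolding eventually_nhds_metric by blast
    \<comment> \<open>A step small enough for the whole parallelogram to stay within distance \<open>d\<close> of \<open>x\<close>.\<close>
    define h where "h = d / (norm a + norm b + 1)"
    have h: "h > 0" using d by (simp add: h_def add_nonneg_pos)
    have near: "dist (x + s *\<^sub>R u + t *\<^sub>R v) x < d"
      if "0 < s" "s < h" "0 < t" "t < h" "norm u + norm v = norm a + norm b" for s t u v
    proof -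
      have "dist (x + s *\<^sub>R u + t *\<^sub>R v) x \<le> s * norm u + t * norm v"
        using norm_triangle_ineq[of "s *\<^sub>R u" "t *\<^sub>R v"] that by (simp add: dist_norm add.assoc)
      also have "\<dots> \<le> h * norm u + h * norm v"
        using that by (intro add_mono mult_right_mono) auto
      also have "\<dots> < h * (norm a + norm b + 1)"
        using that h by (simp add: distrib_left[symmetric])
      also have "\<dots> = d" unfolding h_def using add_nonneg_pos[of "norm a + norm b" 1] by simp
      finally show ?thesis .
    qed
    obtain s t where st: "0 < s" "s < h" "0 < t" "t < h"
      "f (x + h *\<^sub>R a + h *\<^sub>R b) - f (x + h *\<^sub>R a) - f (x + h *\<^sub>R b) + f x = h * h * D2f b a (x + s *\<^sub>R a + t *\<^sub>R b)"
      using second_difference_mean_value[of f Df a "\<lambda>w. D2f w a" h x b, OF f Df h] by blast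
    obtain s' t' where st': "0 < s'" "s' < h" "0 < t'" "t' < h"
      "f (x + h *\<^sub>R b + h *\<^sub>R a) - f (x + h *\<^sub>R b) - f (x + h *\<^sub>R a) + f x = h * h * D2f a b (x + s' *\<^sub>R b + t' *\<^sub>R a)"
      using second_difference_mean_value[of f Df b "\<lambda>w. D2f w b" h x a, OF f Df h] by blast
    have "h * h * D2f b a (x + s *\<^sub>R a + t *\<^sub>R b) = h * h * D2f a b (x + s' *\<^sub>R b + t' *\<^sub>R a)"
      using st(5) st'(5) by (simp add: algebra_simps)
    then have "D2f b a (x + s *\<^sub>R a + t *\<^sub>R b) = D2f a b (x + s' *\<^sub>R b + t' *\<^sub>R a)" using h by simp
    moreover have "D2f b a (x + s *\<^sub>R a + t *\<^sub>R b) < m" using d(2) near[OF st(1-4)] by simp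
    moreover have "m < D2f a b (x + s' *\<^sub>R b + t' *\<^sub>R a)" using d(2) near[OF st'(1-4)] by simp
    ultimately show False by simp
  qed
  show ?thesis using le[of a b] le[of b a] by simp
qed

text \<open>
  The real and imaginary parts are treated separately because the mean value theorem is a statement about
  real functions.
\<close>

lemma dir_deriv_commute:
  assumes "smooth f"
  shows "dir_deriv a (dir_deriv b f) x = dir_deriv b (dir_deriv a f) x"
proof -
  have d: "(g has_derivative (\<lambda>v. dir_deriv v g y)) (at y)" if "smooth g" for g :: "'a \<Rightarrow> complex" and y
    by (rule has_derivative_dir_deriv[OF smooth_differentiable[OF that]])
  have c: "continuous_on UNIV g" if "smooth g" for g :: "'a \<Rightarrow> complex"
    by (metis that smooth_differentiable differentiable_imp_continuous_within continuous_at_imp_continuous_on)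
  note sm = assms smooth_dir_deriv[OF assms] smooth_dir_deriv[OF smooth_dir_deriv[OF assms]]
  have "Re (dir_deriv a (dir_deriv b f) x) = Re (dir_deriv b (dir_deriv a f) x)"
    by (rule real_mixed_derivatives_commute[where f="\<lambda>y. Re (f y)" and Df="\<lambda>v y. Re (dir_deriv v f y)"
          and D2f="\<lambda>w v y. Re (dir_deriv w (dir_deriv v f) y)"])
      (intro has_derivative_Re continuous_on_Re d c sm)+
  moreover have "Im (dir_deriv a (dir_deriv b f) x) = Im (dir_deriv b (dir_deriv a f) x)"
    by (rule real_mixed_derivatives_commute[where f="\<lambda>y. Im (f y)" and Df="\<lambda>v y. Im (dir_deriv v f y)"
          and D2f="\<lambda>w v y. Im (dir_deriv w (dir_deriv v f) y)"])
      (intro has_derivative_Im continuous_on_Im d c sm)+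
  ultimately show ?thesis by (rule complex_eqI)
qed

section \<open>The Hodge Laplacian acts coefficientwise\<close>

definition scalar_laplacian :: "('a::euclidean_space \<Rightarrow> complex) \<Rightarrow> 'a \<Rightarrow> complex" where
  "scalar_laplacian f x = - (\<Sum>b\<in>Basis. dir_deriv b (dir_deriv b f) x)"

text \<open>
  In \<open>d\<delta> + \<delta>d\<close> the terms that differentiate in the direction of an argument of the form occur twice,
  once in either order and with opposite signs; since partial derivatives commute they cancel.
\<close>

lemma hodge_laplacian_eq_scalar_laplacian:
  assumes \<omega>: "\<And>vs. smooth (\<lambda>x. \<omega> x vs)"
  shows "hodge_laplacian \<omega> x vs = scalar_laplacian (\<lambda>y. \<omega> y vs) x"
proof -
  define del where "del i = take i vs @ drop (Suc i) vs" for i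
  let ?\<omega> = "\<lambda>vs x. \<omega> x vs"
  have dif: "dir_deriv v (?\<omega> us) differentiable (at y)" "?\<omega> us differentiable (at y)" for v us y
    by (intro smooth_differentiable smooth_dir_deriv \<omega>)+
  have "ext_deriv (codiff \<omega>) x vs =
      (\<Sum>i<length vs. (-1)^i * dir_deriv (vs!i) (\<lambda>y. - (\<Sum>b\<in>Basis. dir_deriv b (?\<omega> (b # del i)) y)) x)"
    by (simp add: ext_deriv_def codiff_def del_def)
  also have "\<dots> = - (\<Sum>b\<in>Basis. \<Sum>i<length vs. (-1)^i * dir_deriv (vs!i) (dir_deriv b (?\<omega> (b # del i))) x)"
    by (simp add: dir_deriv_uminus dir_deriv_sum dif differentiable_sum sum_negf sum_distrib_left
        sum.swap[of _ Basis])
  finally have 1: "ext_deriv (codiff \<omega>) x vs =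
     - (\<Sum>b\<in>Basis. \<Sum>i<length vs. (-1)^i * dir_deriv (vs!i) (dir_deriv b (?\<omega> (b # del i))) x)" .
  have "codiff (ext_deriv \<omega>) x vs = - (\<Sum>b\<in>Basis. dir_deriv b
      (\<lambda>y. dir_deriv b (?\<omega> vs) y + - (\<Sum>i<length vs. (-1)^i * dir_deriv (vs!i) (?\<omega> (b # del i)) y)) x)"
    by (simp add: codiff_def ext_deriv_def del_def sum.lessThan_Suc_shift sum_negf del: sum.lessThan_Suc)
  also have "\<dots> = - (\<Sum>b\<in>Basis. dir_deriv b (dir_deriv b (?\<omega> vs)) x +
      - (\<Sum>i<length vs. (-1)^i * dir_deriv b (dir_deriv (vs!i) (?\<omega> (b # del i))) x))"
  proof -
    have cdif: "(\<lambda>y. (-1)^i * dir_deriv v (?\<omega> us) y) differentiable (at y)" for i :: nat and v us y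
      by (intro differentiable_mult differentiable_const dif)
    then have sdif: "(\<lambda>y. \<Sum>i<length vs. (-1)^i * dir_deriv (vs!i) (?\<omega> (b # del i)) y) differentiable (at y)" for b y
      by (intro differentiable_sum) auto
    show ?thesis
      unfolding dir_deriv_add[OF dif(1) differentiable_minus[OF sdif]] dir_deriv_uminus[OF sdif]
        dir_deriv_sum[OF cdif] dir_deriv_cmult[OF dif(1)] by simp
  qed
  finally have 2: "codiff (ext_deriv \<omega>) x vs = - (\<Sum>b\<in>Basis. dir_deriv b (dir_deriv b (?\<omega> vs)) x +
      - (\<Sum>i<length vs. (-1)^i * dir_deriv b (dir_deriv (vs!i) (?\<omega> (b # del i))) x))" .
  have 3: "dir_deriv b (dir_deriv (vs!i) (?\<omega> us)) x = dir_deriv (vs!i) (dir_deriv b (?\<omega> us)) x" for b i us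
    by (rule dir_deriv_commute[OF \<omega>])
  show ?thesis
    by (simp add: hodge_laplacian_def 1 2 3 scalar_laplacian_def sum.distrib sum_subtractf)
qed

section \<open>Alternating multilinear functions in coordinates\<close>

lemma covector_linear:
  assumes "\<eta> \<in> covectors q" "length vs = q" "i < q"
  shows "linear (\<lambda>v. \<eta> (vs[i := v]))"
  using assms by (auto simp: covectors_def)

lemma covector_alternating:
  assumes "\<eta> \<in> covectors q" "length vs = q" "i < q" "j < q" "i \<noteq> j" "vs ! i = vs ! j"
  shows "\<eta> vs = 0"
proof -
  have *: "\<forall>vs i j. length vs = q \<and> i < j \<and> j < q \<and> vs ! i = vs ! j \<longrightarrow> \<eta> vs = 0"
    using assms(1) by (simp add: covectors_def)
  show ?thesis
    using *[rule_format, of vs i j] *[rule_format, of vs j i] assms(2-) by (cases i j rule: linorder_cases) auto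
qed

lemma covector_swap:
  assumes \<eta>: "\<eta> \<in> covectors q" and q: "length vs = q" and ij: "i < q" "j < q" "i \<noteq> j"
  shows "\<eta> (vs[i := vs ! j, j := vs ! i]) = - \<eta> vs"
proof -
  define B where "B u v = \<eta> (vs[i := u, j := v])" for u v
  have lin2: "linear (B u)" for u
    unfolding B_def using covector_linear[OF \<eta>, of "vs[i := u]" j] q ij by simp
  have lin1: "linear (\<lambda>u. B u v)" for v
    unfolding B_def using covector_linear[OF \<eta>, of "vs[j := v]" i] q ij
    by (simp add: list_update_swap[OF ij(3)])
  have diag: "B u u = 0" for u
    unfolding B_def by (rule covector_alternating[OF \<eta>, of _ i j]) (use q ij in auto)
  have "0 = B (vs!i + vs!j) (vs!i + vs!j)" by (simp add: diag)
  also have "\<dots> = B (vs!i) (vs!j) + B (vs!j) (vs!i)"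
    unfolding linear_add[OF lin1] linear_add[OF lin2] by (simp add: diag)
  finally have "B (vs!j) (vs!i) = - B (vs!i) (vs!j)" by (metis minus_unique)
  then show ?thesis by (simp add: B_def)
qed

lemma permute_list_transpose_eq_update:
  assumes "i < length vs" "j < length vs" "i \<noteq> j"
  shows "permute_list (Transposition.transpose i j) vs = vs[i := vs ! j, j := vs ! i]"
  using assms by (auto intro!: nth_equalityI simp: permute_list_def nth_list_update Transposition.transpose_def)

text \<open>
  A permutation changes the value by a sign.  Only vanishing matters below, and stating just that keeps the
  sign out of the induction over transpositions.
\<close>

lemma covector_permute_eq_0_iff:
  assumes \<eta>: "\<eta> \<in> covectors q" and p: "p permutes {..<q}" and q: "length vs = q"
  shows "\<eta> (permute_list p vs) = 0 \<longleftrightarrow> \<eta> vs = 0"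
  using p finite_lessThan[of q] q
proof (induction arbitrary: vs rule: permutes_induct)
  case id
  then show ?case by simp
next
  case (swap a b p)
  have "permute_list (Transposition.transpose a b \<circ> p) vs = permute_list p (permute_list (Transposition.transpose a b) vs)"
    using swap by (intro permute_list_compose) auto
  moreover have "\<eta> (permute_list (Transposition.transpose a b) vs) = - \<eta> vs"
    using swap by (simp add: permute_list_transpose_eq_update covector_swap[OF \<eta>])
  ultimately show ?case
    using swap.IH[of "permute_list (Transposition.transpose a b) vs"] swap.prems by (simp only: length_permute_list neg_equal_0_iff_equal)
qed

text \<open>
  An arbitrary enumeration takes the place of an increasing multi-index; another choice changes the basis
  covectors below by signs.
\<close>

definition list_of_set :: "'a set \<Rightarrow> 'a list" where
  "list_of_set S = (SOME l. distinct l \<and> set l = S)"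

lemma list_of_set:
  assumes "finite S"
  shows "distinct (list_of_set S)" "set (list_of_set S) = S" "length (list_of_set S) = card S"
proof -
  show *: "distinct (list_of_set S)" "set (list_of_set S) = S"
    using someI_ex[of "\<lambda>l. distinct l \<and> set l = S"] finite_distinct_list[OF assms]
    by (auto simp: list_of_set_def)
  show "length (list_of_set S) = card S" using distinct_card[OF *(1)] *(2) by simp
qed

definition basis_subsets :: "nat \<Rightarrow> 'a::euclidean_space set set" where
  "basis_subsets q = {S. S \<subseteq> Basis \<and> card S = q}"

lemma basis_subsets:
  assumes "S \<in> basis_subsets q"
  shows "distinct (list_of_set S)" "set (list_of_set S) = S" "length (list_of_set S) = q" "S \<subseteq> Basis"
  using assms list_of_set[of S] finite_subset[OF _ finite_Basis]
  by (auto simp: basis_subsets_def)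

lemma finite_basis_subsets [simp]: "finite (basis_subsets q)"
  unfolding basis_subsets_def by (rule finite_subset[of _ "Pow Basis"]) auto

lemma card_basis_subsets: "card (basis_subsets q :: 'a::euclidean_space set set) = DIM('a) choose q"
  unfolding basis_subsets_def by (rule n_subsets) simp

text \<open>
  Multilinearity reduces to lists of basis vectors; such a list either has a repetition or is a permutation
  of one of the chosen enumerations.
\<close>

lemma covector_eq_0I:
  fixes \<eta> :: "'a::euclidean_space covector"
  assumes \<eta>: "\<eta> \<in> covectors q"
    and zero: "\<And>S. S \<in> basis_subsets q \<Longrightarrow> \<eta> (list_of_set S) = 0"
  shows "\<eta> = 0"
proof -
  have basis: "\<eta> vs = 0" if vs: "length vs = q" "set vs \<subseteq> Basis" for vs
  proof (cases "distinct vs")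
    case True
    then have S: "set vs \<in> basis_subsets q"
      using vs by (auto simp: basis_subsets_def distinct_card)
    then have "mset vs = mset (list_of_set (set vs))"
      using True basis_subsets(1,2)[OF S] set_eq_iff_mset_eq_distinct by blast
    then obtain p where "p permutes {..<q}" "permute_list p (list_of_set (set vs)) = vs"
      using mset_eq_permutation basis_subsets(3)[OF S] by metis
    then show ?thesis
      using covector_permute_eq_0_iff[OF \<eta>, of p "list_of_set (set vs)"] zero[OF S]
        basis_subsets(3)[OF S] by simp
  next
    case False
    then obtain i j where "i < length vs" "j < length vs" "i \<noteq> j" "vs ! i = vs ! j"
      by (auto simp: distinct_conv_nth)
    then show ?thesis using covector_alternating[OF \<eta>] vs by blast
  qed
  \<comment> \<open>Multilinearity frees the slots one after the other.\<close>
  have "\<eta> vs = 0" if "k \<le> q" "length vs = q" "\<forall>i. k \<le> i \<and> i < q \<longrightarrow> vs ! i \<in> Basis" for k vs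
    using that
  proof (induction k arbitrary: vs)
    case 0
    then show ?case by (intro basis) (auto simp: in_set_conv_nth)
  next
    case (Suc k)
    have "(\<lambda>v. \<eta> (vs[k := v])) = (\<lambda>v. 0)"
    proof (rule linear_eq_stdbasis)
      show "linear (\<lambda>v. \<eta> (vs[k := v]))" by (rule covector_linear[OF \<eta>]) (use Suc in auto)
      show "\<eta> (vs[k := b]) = 0" if "b \<in> Basis" for b
        by (rule Suc.IH) (use Suc.prems that in \<open>auto simp: nth_list_update\<close>)
    qed (auto intro: linearI)
    from fun_cong[OF this, of "vs ! k"] show ?case by simp
  qed
  from this[of q] \<eta> have "\<eta> vs = 0" for vs
    by (cases "length vs = q") (force, simp add: covectors_def)
  then show ?thesis by (simp add: fun_eq_iff)
qed

text \<open>
  The determinant of the matrix of inner products of \<open>L\<close> with the arguments, which is the exterior product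
  of the covectors dual to the entries of \<open>L\<close>.
\<close>

definition det_covector :: "'a::euclidean_space list \<Rightarrow> 'a covector" where
  "det_covector L vs = (if length vs = length L
     then \<Sum>p | p permutes {..<length L}.
       of_int (sign p) * (\<Prod>i<length L. complex_of_real (L ! i \<bullet> vs ! p i)) else 0)"

lemma det_covector_in_covectors: "det_covector L \<in> covectors (length L)"
proof -
  define q where "q = length L"
  have lin: "linear (\<lambda>v. det_covector L (vs[j := v]))" if vs: "length vs = q" "j < q" for vs j
  proof -
    have "linear (\<lambda>v. of_int (sign p) * (\<Prod>i<q. complex_of_real (L ! i \<bullet> vs[j := v] ! p i)))"
      if p: "p permutes {..<q}" for p
    proof -
      have "inv p j \<in> {..<q}" using permutes_in_image[OF permutes_inv[OF p], of j] vs by simp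
      \<comment> \<open>Exactly one factor of the product involves the slot \<open>j\<close>.\<close>
      have "(\<Prod>i<q. complex_of_real (L ! i \<bullet> vs[j := v] ! p i)) =
          complex_of_real (L ! inv p j \<bullet> v) * (\<Prod>i\<in>{..<q} - {inv p j}. complex_of_real (L ! i \<bullet> vs ! p i))" for v
      proof -
        have "(\<Prod>i<q. complex_of_real (L ! i \<bullet> vs[j := v] ! p i)) =
            complex_of_real (L ! inv p j \<bullet> vs[j := v] ! p (inv p j)) *
            (\<Prod>i\<in>{..<q} - {inv p j}. complex_of_real (L ! i \<bullet> vs[j := v] ! p i))"
          by (rule prod.remove) (use \<open>inv p j \<in> {..<q}\<close> in auto)
        also have "(\<Prod>i\<in>{..<q} - {inv p j}. complex_of_real (L ! i \<bullet> vs[j := v] ! p i)) =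
            (\<Prod>i\<in>{..<q} - {inv p j}. complex_of_real (L ! i \<bullet> vs ! p i))"
          using p by (intro prod.cong refl) (metis DiffD2 insertCI nth_list_update_neq permutes_inverses(2))
        also have "vs[j := v] ! p (inv p j) = v"
          using p vs by (simp add: permutes_inverses)
        finally show ?thesis .
      qed
      then show ?thesis
        by (intro linearI) (auto simp: algebra_simps inner_add_right inner_scaleR_right scaleR_conv_of_real)
    qed
    then have "linear (\<lambda>v. \<Sum>p | p permutes {..<q}.
        of_int (sign p) * (\<Prod>i<q. complex_of_real (L ! i \<bullet> vs[j := v] ! p i)))"
      by (intro linear_compose_sum) auto
    then show ?thesis using vs by (simp add: det_covector_def q_def)
  qed
  have alt: "det_covector L vs = 0" if vs: "length vs = q" "i < j" "j < q" "vs ! i = vs ! j" for vs i j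
  proof -
    define f where "f p = of_int (sign p) * (\<Prod>k<q. complex_of_real (L ! k \<bullet> vs ! p k))" for p
    define \<tau> where "\<tau> = Transposition.transpose i j"
    have \<tau>: "\<tau> permutes {..<q}" unfolding \<tau>_def by (rule permutes_swap_id) (use vs in auto)
    \<comment> \<open>Composing with the transposition changes the sign of each term and nothing else.\<close>
    have "f (\<tau> \<circ> p) = - f p" if "p permutes {..<q}" for p
    proof -
      have "sign (\<tau> \<circ> p) = - sign p"
        using that \<tau> vs by (subst sign_compose)
          (auto simp: permutation_permutes sign_swap_id \<tau>_def intro: exI[of _ "{..<q}"])
      moreover have "vs ! (\<tau> (p k)) = vs ! p k" for k
        using vs by (auto simp: \<tau>_def Transposition.transpose_def)
      ultimately show ?thesis by (simp add: f_def)
    qed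
    then have "(\<Sum>p | p permutes {..<q}. f p) = (\<Sum>p | p permutes {..<q}. - f p)"
      by (subst setum_permutations_compose_left[OF \<tau>]) auto
    then have "(\<Sum>p | p permutes {..<q}. f p) = 0" by (simp add: sum_negf)
    then show ?thesis using vs by (simp add: det_covector_def q_def f_def)
  qed
  show ?thesis
    unfolding covectors_def using lin alt by (auto simp: q_def det_covector_def)
qed

definition basis_covector :: "'a::euclidean_space set \<Rightarrow> 'a covector" where
  "basis_covector S = det_covector (list_of_set S)"

lemma basis_covector_in_covectors: "S \<in> basis_subsets q \<Longrightarrow> basis_covector S \<in> covectors q"
  unfolding basis_covector_def using det_covector_in_covectors basis_subsets(3) by metis

lemma basis_covector_dual:
  assumes S: "S \<in> basis_subsets q" and T: "T \<in> basis_subsets q"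
  shows "basis_covector S (list_of_set T) = (if S = T then 1 else 0)"
proof -
  define L where "L = list_of_set S"
  define M where "M = list_of_set T"
  have L: "distinct L" "set L = S" "length L = q" "set L \<subseteq> Basis"
    and M: "distinct M" "set M = T" "length M = q" "set M \<subseteq> Basis"
    using basis_subsets[OF S] basis_subsets[OF T] by (auto simp: L_def M_def)
  have inner: "L ! i \<bullet> M ! j = (if L ! i = M ! j then 1 else 0)" if "i < q" "j < q" for i j
    using that L M by (auto simp: inner_Basis subset_iff)
  \<comment> \<open>A nonzero term matches every entry of the one list with an entry of the other, which forces the lists
    and then the permutation to be trivial.\<close>
  have single: "of_int (sign p) * (\<Prod>i<q. complex_of_real (L ! i \<bullet> M ! p i)) = (if S = T \<and> p = id then 1 else 0)"
    if p: "p permutes {..<q}" for p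
  proof (cases "\<forall>i<q. L ! i = M ! p i")
    case True
    have pq: "p i < q" if "i < q" for i using permutes_in_image[OF p, of i] that by simp
    have "set L \<subseteq> set M"
    proof
      fix x assume "x \<in> set L"
      then obtain i where "i < q" "x = L ! i" using L(3) by (auto simp: in_set_conv_nth)
      then show "x \<in> set M" using True M(3) pq by simp
    qed
    then have ST: "S = T" using L M finite_set[of M]
      by (metis card_subset_eq distinct_card)
    then have "L = M" by (simp add: L_def M_def)
    have "p i = i" if "i < q" for i
      using True[rule_format, OF that] \<open>L = M\<close> M(1,3) pq[OF that] that by (simp add: nth_eq_iff_index_eq)
    then have "p = id" using p by (auto simp: fun_eq_iff permutes_def)
    then show ?thesis using ST inner by (simp add: \<open>L = M\<close>)
  next
    case False
    then obtain i where i: "i < q" "L ! i \<noteq> M ! p i" by blast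
    have "p i < q" using permutes_in_image[OF p, of i] i by simp
    then have "(\<Prod>i<q. complex_of_real (L ! i \<bullet> M ! p i)) = 0"
      using i inner[of i "p i"] by (intro prod_zero) auto
    moreover have "\<not> (S = T \<and> p = id)" using i by (auto simp: L_def M_def)
    ultimately show ?thesis by (simp only: if_False mult_zero_right)
  qed
  have "basis_covector S M = (\<Sum>p | p permutes {..<q}. if S = T \<and> p = id then 1 else 0)"
    using L M by (simp add: basis_covector_def det_covector_def single flip: L_def)
  also have "\<dots> = (\<Sum>p\<in>{id :: nat \<Rightarrow> nat}. if S = T then 1 else 0)"
    by (rule sum.mono_neutral_cong_right) (auto simp: finite_permutations permutes_id)
  finally show ?thesis by (simp add: M_def)
qed

lemma sum_fun_apply: "(\<Sum>i\<in>I. f i) x = (\<Sum>i\<in>I. f i x)"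
  by (induction I rule: infinite_finite_induct) auto

interpretation covector: vector_space covector_scale
  by (rule vector_space_covector_scale)

interpretation form: vector_space form_scale
  by (rule vector_space_form_scale)

lemma covectors_subspace: "covector.subspace (covectors q)"
proof -
  have "\<eta> + \<theta> \<in> covectors q" if "\<eta> \<in> covectors q" "\<theta> \<in> covectors q" for \<eta> \<theta> :: "'a covector"
    using that unfolding covectors_def by (auto intro: linear_compose_add)
  moreover have "covector_scale c \<eta> \<in> covectors q" if "\<eta> \<in> covectors q" for c and \<eta> :: "'a covector"
  proof -
    have "linear (\<lambda>v. c * g v)" if "linear g" for g :: "'a \<Rightarrow> complex"
      using linear_compose[OF that bounded_linear.linear[OF bounded_linear_mult_right[of c]]]
      by (simp add: o_def)
    then show ?thesis using that unfolding covectors_def covector_scale_def by auto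
  qed
  moreover have "0 \<in> covectors q" by (auto simp: covectors_def intro: linearI)
  ultimately show ?thesis unfolding covector.subspace_def by blast
qed

lemma covector_expansion:
  assumes "\<eta> \<in> covectors q"
  shows "\<eta> = (\<Sum>S\<in>basis_subsets q. covector_scale (\<eta> (list_of_set S)) (basis_covector S))"
proof -
  let ?\<theta> = "\<Sum>S\<in>basis_subsets q. covector_scale (\<eta> (list_of_set S)) (basis_covector S)"
  have "\<eta> - ?\<theta> \<in> covectors q"
    by (intro covector.subspace_diff covector.subspace_sum covector.subspace_scale
        covectors_subspace assms basis_covector_in_covectors)
  moreover have "(\<eta> - ?\<theta>) (list_of_set T) = 0" if T: "T \<in> basis_subsets q" for T
  proof -
    have "?\<theta> (list_of_set T) = (\<Sum>S\<in>basis_subsets q. if S = T then \<eta> (list_of_set S) else 0)"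
      unfolding sum_fun_apply by (intro sum.cong) (auto simp: covector_scale_def basis_covector_dual[OF _ T])
    then show ?thesis using T by simp
  qed
  ultimately have "\<eta> - ?\<theta> = 0" by (rule covector_eq_0I)
  then show ?thesis by simp
qed

lemma dim_covectors:
  "covector.dim (covectors q :: 'a::euclidean_space covector set) = DIM('a) choose q"
proof (rule covector.dim_unique)
  let ?I = "basis_subsets q :: 'a set set"
  show "basis_covector ` ?I \<subseteq> covectors q" using basis_covector_in_covectors by blast
  show "covectors q \<subseteq> covector.span (basis_covector ` ?I)"
  proof
    fix \<eta> :: "'a covector" assume "\<eta> \<in> covectors q"
    then show "\<eta> \<in> covector.span (basis_covector ` ?I)"
      by (subst covector_expansion[of _ q]) 
        (auto intro!: covector.span_sum intro: covector.span_scale covector.span_base)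
  qed
  have inj: "inj_on basis_covector ?I"
    by (rule inj_onI) (metis basis_covector_dual zero_neq_one)
  then show "card (basis_covector ` ?I) = DIM('a) choose q"
    by (simp add: card_image card_basis_subsets)
  show "covector.independent (basis_covector ` ?I)"
    unfolding covector.independent_explicit_module
  proof (intro allI impI)
    fix t :: "'a covector set" and u v assume t: "finite t" "t \<subseteq> basis_covector ` ?I" "(\<Sum>v\<in>t. covector_scale (u v) v) = 0" "v \<in> t"
    then obtain J where J: "J \<subseteq> ?I" "t = basis_covector ` J" by (meson subset_imageE)
    then obtain T where T: "T \<in> J" "v = basis_covector T" using t by blast
    have "0 = (\<Sum>v\<in>t. covector_scale (u v) v) (list_of_set T)" using t by simp
    also have "\<dots> = (\<Sum>S\<in>J. covector_scale (u (basis_covector S)) (basis_covector S) (list_of_set T))"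
      unfolding sum_fun_apply J(2) by (rule sum.reindex_cong[OF inj_on_subset[OF inj J(1)]]) auto
    also have "\<dots> = (\<Sum>S\<in>J. if S = T then u (basis_covector S) else 0)"
    proof (rule sum.cong[OF refl])
      fix S assume "S \<in> J"
      then show "covector_scale (u (basis_covector S)) (basis_covector S) (list_of_set T) =
          (if S = T then u (basis_covector S) else 0)"
        using basis_covector_dual[OF subsetD[OF J(1)] subsetD[OF J(1) T(1)], of S] by (simp add: covector_scale_def)
    qed
    also have "\<dots> = u v" using T J finite_subset[OF J(1)] by simp
    finally show "u v = 0" by simp
  qed
qed

section \<open>Forms with coefficients in a space of functions\<close>

definition fun_scale :: "complex \<Rightarrow> ('a \<Rightarrow> complex) \<Rightarrow> 'a \<Rightarrow> complex" where
  "fun_scale c f = (\<lambda>x. c * f x)"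

interpretation func: vector_space fun_scale
  by unfold_locales (auto simp: fun_scale_def fun_eq_iff algebra_simps)

text \<open>
  This is \<open>W\<close> tensored with the \<open>q\<close>-covectors.  Coefficients are taken along all lists \<open>vs\<close>, so that the
  definition involves no choice of a basis.
\<close>

definition forms_with_coeffs :: "nat \<Rightarrow> ('a::euclidean_space \<Rightarrow> complex) set \<Rightarrow> 'a form set" where
  "forms_with_coeffs q W = {\<omega>. (\<forall>x. \<omega> x \<in> covectors q) \<and> (\<forall>vs. (\<lambda>x. \<omega> x vs) \<in> W)}"

definition simple_form :: "('a::euclidean_space \<Rightarrow> complex) \<Rightarrow> 'a set \<Rightarrow> 'a form" where
  "simple_form f S = (\<lambda>x. covector_scale (f x) (basis_covector S))"

lemma simple_form_in_forms_with_coeffs: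
  assumes W: "func.subspace W" and f: "f \<in> W" and S: "S \<in> basis_subsets q"
  shows "simple_form f S \<in> forms_with_coeffs q W"
proof -
  have "(\<lambda>x. f x * basis_covector S vs) \<in> W" for vs
    using func.subspace_scale[OF W f, of "basis_covector S vs"] by (simp add: fun_scale_def mult.commute)
  then show ?thesis
    using covector.subspace_scale[OF covectors_subspace basis_covector_in_covectors[OF S]]
    by (simp add: forms_with_coeffs_def simple_form_def covector_scale_def)
qed

lemma simple_form_dual:
  "S \<in> basis_subsets q \<Longrightarrow> T \<in> basis_subsets q \<Longrightarrow>
    simple_form f S x (list_of_set T) = (if S = T then f x else 0)"
  by (simp add: simple_form_def covector_scale_def basis_covector_dual)

lemma form_expansion:
  assumes "\<omega> \<in> forms_with_coeffs q W"
  shows "\<omega> = (\<Sum>S\<in>basis_subsets q. simple_form (\<lambda>x. \<omega> x (list_of_set S)) S)"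
  using assms covector_expansion[of _ q]
  by (fastforce simp: forms_with_coeffs_def simple_form_def fun_eq_iff sum_fun_apply)

text \<open>
  The products of a basis of \<open>W\<close> with the basis covectors form a basis.  The argument also covers an
  infinite-dimensional \<open>W\<close>: both bases are then infinite, or the second one is empty, and both sides are \<open>0\<close>.
\<close>

lemma dim_forms_with_coeffs:
  fixes W :: "('a::euclidean_space \<Rightarrow> complex) set"
  assumes W: "func.subspace W"
  shows "form.dim (forms_with_coeffs q W) = (DIM('a) choose q) * func.dim W"
proof -
  obtain B where B: "B \<subseteq> W" "func.independent B" "W \<subseteq> func.span B" "card B = func.dim W"
    by (rule func.basis_exists)
  let ?I = "basis_subsets q :: 'a set set"
  let ?C = "case_prod simple_form ` (B \<times> ?I)"
  have nz: "f \<noteq> 0" if "f \<in> B" for f using B(2) func.dependent_zero that by blast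
  have inj: "inj_on (case_prod simple_form) (B \<times> ?I)"
  proof (rule inj_onI, clarify)
    fix f g S T assume *: "f \<in> B" "g \<in> B" "S \<in> ?I" "T \<in> ?I" "simple_form f S = simple_form g T"
    have eq: "f x = (if T = S then g x else 0)" for x
      using simple_form_dual[OF *(3,3), of f x] simple_form_dual[OF *(4,3), of g x] *(5) by simp
    then have "T = S" using nz[OF *(1)] by (auto simp: fun_eq_iff split: if_splits)
    then show "f = g \<and> S = T" using eq by auto
  qed
  show ?thesis
  proof (rule form.dim_unique)
    show "?C \<subseteq> forms_with_coeffs q W"
      using simple_form_in_forms_with_coeffs[OF W] B(1) by auto
    show "card ?C = (DIM('a) choose q) * func.dim W"
      using inj by (simp add: card_image card_basis_subsets card_cartesian_product B(4))
    show "forms_with_coeffs q W \<subseteq> form.span ?C"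
    proof
      fix \<omega> assume \<omega>: "\<omega> \<in> forms_with_coeffs q W"
      have "simple_form f S \<in> form.span ?C" if "f \<in> func.span B" "S \<in> ?I" for f S
        using that(1)
      proof (induction rule: func.span_induct_alt)
        case base
        have "simple_form 0 S = 0" by (simp add: simple_form_def fun_eq_iff covector_scale_def)
        then show ?case by (metis form.span_zero)
      next
        case (step c f g)
        have "simple_form (fun_scale c f + g) S = form_scale c (simple_form f S) + simple_form g S"
          by (simp add: simple_form_def fun_scale_def form_scale_def covector_scale_def fun_eq_iff algebra_simps)
        moreover have "simple_form f S \<in> form.span ?C"
          using step(1) that(2) by (intro form.span_base) auto
        ultimately show ?case using step(2) by (metis form.span_add form.span_scale)
      qed
      then show "\<omega> \<in> form.span ?C"
        using \<omega> B(3) by (subst form_expansion[OF \<omega>]) (auto intro!: form.span_sum simp: forms_with_coeffs_def subset_iff)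
    qed
    show "form.independent ?C"
      unfolding form.independent_explicit_module
    proof (intro allI impI)
      fix t :: "'a form set" and u v assume t: "finite t" "t \<subseteq> ?C" "(\<Sum>v\<in>t. form_scale (u v) v) = 0" "v \<in> t"
      then obtain J where J: "J \<subseteq> B \<times> ?I" "t = case_prod simple_form ` J" by (meson subset_imageE)
      have finJ: "finite J" using t(1) J inj finite_image_iff inj_on_subset by metis
      obtain g T where T: "(g, T) \<in> J" "v = simple_form g T" using t(4) J by auto
      define B' where "B' = {f. (f, T) \<in> J}"
      have finB': "finite B'" unfolding B'_def by (rule finite_subset[OF _ finite_imageI[OF finJ, of fst]]) force
      have "(\<Sum>f\<in>B'. fun_scale (u (simple_form f T)) f) = 0"
      proof
        fix x
        have "0 = (\<Sum>v\<in>t. form_scale (u v) v) x (list_of_set T)" using t by simp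
        also have "\<dots> = (\<Sum>(f, S)\<in>J. u (simple_form f S) * simple_form f S x (list_of_set T))"
          unfolding sum_fun_apply J(2)
          by (rule sum.reindex_cong[OF inj_on_subset[OF inj J(1)]]) (auto simp: form_scale_def)
        also have "\<dots> = (\<Sum>(f, S)\<in>J. if S = T then u (simple_form f T) * f x else 0)"
          using J T by (intro sum.cong) (auto simp: simple_form_dual[of _ q] subset_iff)
        also have "\<dots> = (\<Sum>(f, S)\<in>(\<lambda>f. (f, T)) ` B'. u (simple_form f T) * f x)"
          by (rule sum.mono_neutral_cong_right[OF finJ]) (auto simp: B'_def)
        also have "\<dots> = (\<Sum>f\<in>B'. u (simple_form f T) * f x)"
          by (subst sum.reindex) (auto simp: inj_on_def)
        finally show "(\<Sum>f\<in>B'. fun_scale (u (simple_form f T)) f) x = 0 x"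
          by (simp add: sum_fun_apply fun_scale_def)
      qed
      then have "u (simple_form g T) = 0"
        using func.independentD[OF B(2) finB', of "\<lambda>f. u (simple_form f T)" g] J T by (auto simp: B'_def)
      then show "u v = 0" using T by simp
    qed
  qed
qed

lemma basis_subsets_nonempty:
  assumes "q \<le> DIM('a::euclidean_space)" shows "basis_subsets q \<noteq> ({} :: 'a set set)"
  using assms card_basis_subsets[where 'a='a, of q] by (metis binomial_eq_0_iff card.empty not_less)

lemma forms_with_coeffs_nonzero_iff:
  fixes W :: "('a::euclidean_space \<Rightarrow> complex) set"
  assumes W: "func.subspace W" and q: "q \<le> DIM('a)"
  shows "(\<exists>\<omega>\<in>forms_with_coeffs q W. \<omega> \<noteq> 0) \<longleftrightarrow> (\<exists>f\<in>W. f \<noteq> 0)"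
proof
  assume "\<exists>\<omega>\<in>forms_with_coeffs q W. \<omega> \<noteq> 0"
  then obtain \<omega> x vs where \<omega>: "\<omega> \<in> forms_with_coeffs q W" "\<omega> x vs \<noteq> 0" by (auto simp: fun_eq_iff)
  then have "(\<lambda>x. \<omega> x vs) \<in> W" by (simp add: forms_with_coeffs_def)
  then show "\<exists>f\<in>W. f \<noteq> 0" using \<omega>(2) by (metis zero_fun_apply)
next
  assume "\<exists>f\<in>W. f \<noteq> 0"
  then obtain f where f: "f \<in> W" "f \<noteq> 0" by blast
  obtain S :: "'a set" where S: "S \<in> basis_subsets q" using basis_subsets_nonempty[OF q] by blast
  from f(2) obtain x where "f x \<noteq> 0" by (auto simp: fun_eq_iff)
  then have "simple_form f S \<noteq> 0" using simple_form_dual[OF S S, of f x] by (metis zero_fun_apply)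
  then show "\<exists>\<omega>\<in>forms_with_coeffs q W. \<omega> \<noteq> 0" using simple_form_in_forms_with_coeffs[OF W f(1) S] by blast
qed

section \<open>The zeta function of a shifted lattice\<close>

text \<open>
  This is \<open>x\<^sup>-\<^sup>w\<close> for \<open>x > 0\<close>.  Written with the exponential it is visibly entire in \<open>w\<close>, whatever \<open>x\<close> is.
\<close>

definition pow_term :: "real \<Rightarrow> complex \<Rightarrow> complex" where
  "pow_term x w = exp (- (w * of_real (ln x)))"

lemma pow_term_eq_powr: "x > 0 \<Longrightarrow> pow_term x w = of_real x powr (- w)"
  by (simp add: pow_term_def powr_def Ln_of_real)

lemma pow_term_0 [simp]: "pow_term x 0 = 1"
  by (simp add: pow_term_def)

lemma pow_term_mult: "x > 0 \<Longrightarrow> y > 0 \<Longrightarrow> pow_term (x * y) w = pow_term x w * pow_term y w"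
  by (simp add: pow_term_def ln_mult exp_add[symmetric] ring_distribs)

lemma pow_term_square: "x \<noteq> 0 \<Longrightarrow> pow_term (x\<^sup>2) w = pow_term \<bar>x\<bar> (2 * w)"
  using ln_realpow[of "\<bar>x\<bar>" 2] by (simp add: pow_term_def mult_ac)

lemma norm_pow_term: "x > 0 \<Longrightarrow> norm (pow_term x w) = x powr (- Re w)"
  by (simp add: pow_term_def powr_def)

lemma has_field_derivative_pow_term [derivative_intros]:
  assumes "(f has_field_derivative f') (at w)"
  shows "((\<lambda>w. pow_term x (f w)) has_field_derivative - (of_real (ln x) * pow_term x (f w)) * f') (at w)"
  unfolding pow_term_def by (rule derivative_eq_intros assms refl | simp)+

definition second_diff :: "real \<Rightarrow> nat \<Rightarrow> complex \<Rightarrow> complex" where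
  "second_diff t n w = pow_term (real n + 1 + t) w + pow_term (real n + 1 - t) w - 2 * pow_term (real n + 1) w"

definition second_diff' :: "real \<Rightarrow> nat \<Rightarrow> complex \<Rightarrow> complex" where
  "second_diff' t n w = - (of_real (ln (real n + 1 + t)) * pow_term (real n + 1 + t) w)
     - of_real (ln (real n + 1 - t)) * pow_term (real n + 1 - t) w
     + 2 * (of_real (ln (real n + 1)) * pow_term (real n + 1) w)"

lemma second_diff_has_derivative:
  "(second_diff t n has_field_derivative second_diff' t n w) (at w)"
  unfolding second_diff_def[abs_def] second_diff'_def
  by (rule derivative_eq_intros refl | simp)+

text \<open>
  Taylor expansion of \<open>z\<^sup>-\<^sup>w\<close> about \<open>n + 1\<close>: the linear terms at \<open>n + 1 + t\<close> and \<open>n + 1 - t\<close> cancel, and the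
  remainders are bounded by the second derivative \<open>w (w + 1) z\<^sup>-\<^sup>w\<^sup>-\<^sup>2\<close>, which decreases in \<open>\<bar>z\<bar>\<close> as long as \<open>Re w \<ge> -2\<close>.
\<close>

lemma norm_second_diff_le:
  assumes n: "n \<ge> 1" and t: "0 \<le> t" "t \<le> 1" and w: "Re w \<ge> -2"
  shows "norm (second_diff t n w) \<le> 2 * (norm w * (norm w + 1) * real n powr (- Re w - 2))"
proof -
  let ?c = "complex_of_real (real n + 1)"
  define S where "S = closed_segment (complex_of_real (real n)) (of_real (real n + 2))"
  define B where "B = norm w * (norm w + 1) * real n powr (- Re w - 2)"
  define f where "f i z = (if i = (0::nat) then z powr (-w)
      else if i = 1 then - w * z powr (-w - 1) else w * (w + 1) * z powr (- w - 2))" for i and z :: complex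
  have S: "\<exists>x. z = of_real x \<and> real n \<le> x" if "z \<in> S" for z
    using that unfolding S_def closed_segment_of_real by (auto simp: closed_segment_eq_real_ivl)
  have nonpos: "z \<notin> \<real>\<^sub>\<le>\<^sub>0" if "z \<in> S" for z
    using S[OF that] n by (auto simp: complex_nonpos_Reals_iff)
  have bound: "norm (f (Suc 1) z) \<le> B" if z: "z \<in> S" for z
  proof -
    obtain x where x: "z = of_real x" "real n \<le> x" using S[OF z] by blast
    have "norm (f (Suc 1) z) = norm w * norm (w + 1) * x powr (- Re w - 2)"
      using x n by (simp add: f_def norm_mult norm_powr_real_powr)
    also have "\<dots> \<le> norm w * (norm w + 1) * real n powr (- Re w - 2)"
      using x n w norm_triangle_ineq[of w 1] by (intro mult_mono powr_mono2') auto
    finally show ?thesis by (simp add: B_def)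
  qed
  have der: "(f i has_field_derivative f (Suc i) z) (at z within S)" if z: "z \<in> S" and i: "i \<le> 1" for i z
  proof -
    note d = has_field_derivative_powr[OF nonpos[OF z]]
    have "(f 0 has_field_derivative f 1 z) (at z)"
      unfolding f_def using d[of "-w"] by simp
    moreover have "(f 1 has_field_derivative f 2 z) (at z)"
      unfolding f_def using DERIV_cmult[OF d[of "-w-1"], of "-w"] by (simp add: algebra_simps)
    ultimately have "(f i has_field_derivative f (Suc i) z) (at z)"
      using i by (cases i) (auto simp: numeral_2_eq_2)
    then show ?thesis by (rule has_field_derivative_at_within)
  qed
  have cS: "?c + of_real u \<in> S" if "-1 \<le> u" "u \<le> 1" for u
  proof -
    have "?c + of_real u = of_real (real n + 1 + u)" by simp
    moreover have "real n + 1 + u \<in> closed_segment (real n) (real n + 2)"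
      using that by (auto simp: closed_segment_eq_real_ivl)
    ultimately show ?thesis unfolding S_def closed_segment_of_real by blast
  qed
  have T: "norm (f 0 (?c + of_real u) - (f 0 ?c + f 1 ?c * of_real u)) \<le> B" if u: "-1 \<le> u" "u \<le> 1" for u
  proof -
    have "norm (f 0 (?c + of_real u) - (\<Sum>i\<le>1. f i ?c * (?c + of_real u - ?c) ^ i / fact i))
        \<le> B * norm (?c + of_real u - ?c) ^ Suc 1 / fact 1"
      by (rule complex_Taylor[of S 1 f B]) (use der bound cS[of 0] cS[OF u] in \<open>auto simp: S_def\<close>)
    also have "\<dots> = B * u^2" by (simp add: power2_eq_square)
    also have "\<dots> \<le> B * 1"
      using u by (intro mult_left_mono) (auto simp: B_def abs_square_le_1 abs_le_iff)
    finally show ?thesis by simp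
  qed
  have f0: "pow_term (real n + 1 + u) w = f 0 (?c + of_real u)" if "-1 \<le> u" "u \<le> 1" for u
    using that n by (simp add: f_def pow_term_eq_powr)
  have "second_diff t n w = (f 0 (?c + of_real t) - (f 0 ?c + f 1 ?c * of_real t)) +
      (f 0 (?c + of_real (-t)) - (f 0 ?c + f 1 ?c * of_real (-t)))"
    using f0[of t] f0[of "-t"] f0[of 0] t by (simp add: second_diff_def)
  also have "norm \<dots> \<le> B + B"
    by (rule order.trans[OF norm_triangle_ineq add_mono[OF T T]]) (use t in auto)
  finally show ?thesis by (simp add: B_def)
qed

text \<open>
  The gain of two powers in the second differences makes this series converge, and holomorphic, to the left
  of \<open>Re w = 0\<close>; there it serves as the regular part of the lattice zeta functions.
\<close>

definition sym_zeta :: "real \<Rightarrow> complex \<Rightarrow> complex" where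
  "sym_zeta t w = (\<Sum>n. second_diff t n w)"

text \<open>
  On the unit ball about any point of the half plane the terms are \<open>O(n powr (-3/2))\<close>, so the series may be
  differentiated term by term.
\<close>

lemma sym_zeta_sums_and_derivative:
  assumes t: "0 \<le> t" "t \<le> 1" and w: "Re w > -1/2"
  shows "(\<lambda>n. second_diff t n w) sums sym_zeta t w"
    and "(\<lambda>n. second_diff' t n w) sums deriv (sym_zeta t) w"
    and "(sym_zeta t has_field_derivative deriv (sym_zeta t) w) (at w)"
proof -
  let ?S = "{w. Re w > -1/2}"
  have ev: "\<exists>d h. 0 < d \<and> summable h \<and>
      (\<forall>\<^sub>F n in sequentially. \<forall>y\<in>ball x d \<inter> ?S. norm (second_diff t n y) \<le> h n)" for x
  proof -
    define R where "R = norm x + 1"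
    define h where "h n = 2 * (R * (R + 1)) * real n powr (-3/2)" for n
    have R: "R \<ge> 0" by (simp add: R_def)
    have "norm (second_diff t n y) \<le> h n" if n: "n \<ge> 1" and y: "y \<in> ball x 1 \<inter> ?S" for n y
    proof -
      have ny: "norm y \<le> R" using y norm_triangle_ineq2[of y x]
        by (simp add: R_def dist_norm norm_minus_commute)
      have "norm (second_diff t n y) \<le> 2 * (norm y * (norm y + 1) * real n powr (- Re y - 2))"
        using y by (intro norm_second_diff_le n t) auto
      also have "\<dots> \<le> 2 * (R * (R + 1) * real n powr (-3/2))"
      proof -
        have "- 1 / 2 < Re y" using y by simp
        then have "- Re y - 2 \<le> - 3 / 2" by (simp add: field_simps)
        then have "real n powr (- Re y - 2) \<le> real n powr (- 3 / 2)" using n by (intro powr_mono) auto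
        then show ?thesis using ny R by (intro mult_left_mono mult_mono) auto
      qed
      finally show ?thesis by (simp add: h_def)
    qed
    then have "\<forall>\<^sub>F n in sequentially. \<forall>y\<in>ball x 1 \<inter> ?S. norm (second_diff t n y) \<le> h n"
      unfolding eventually_sequentially by (intro exI[of _ 1]) blast
    moreover have "summable h" unfolding h_def
      by (intro summable_mult) (simp add: summable_real_powr_iff)
    ultimately show ?thesis by (intro exI[of _ 1] exI[of _ h]) auto
  qed
  have "\<exists>g g'. \<forall>x\<in>?S. ((\<lambda>n. second_diff t n x) sums g x) \<and> ((\<lambda>n. second_diff' t n x) sums g' x) \<and>
      (g has_field_derivative g' x) (at x)"
    by (rule series_and_derivative_comparison_local[OF open_halfspace_Re_gt second_diff_has_derivative ev])
  then obtain g g' where g: "\<And>x. x \<in> ?S \<Longrightarrow> (\<lambda>n. second_diff t n x) sums g x"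
      "\<And>x. x \<in> ?S \<Longrightarrow> (\<lambda>n. second_diff' t n x) sums g' x"
      "\<And>x. x \<in> ?S \<Longrightarrow> (g has_field_derivative g' x) (at x)" by blast
  have eq: "sym_zeta t x = g x" if "x \<in> ?S" for x
    unfolding sym_zeta_def using g(1)[OF that] by (simp add: sums_iff)
  have d: "(sym_zeta t has_field_derivative g' w) (at w)"
    by (rule has_field_derivative_transform_within_open[OF g(3) open_halfspace_Re_gt]) (use w eq in auto)
  then have "deriv (sym_zeta t) w = g' w" by (rule DERIV_imp_deriv)
  with d g w eq show "(\<lambda>n. second_diff t n w) sums sym_zeta t w"
    and "(\<lambda>n. second_diff' t n w) sums deriv (sym_zeta t) w"
    and "(sym_zeta t has_field_derivative deriv (sym_zeta t) w) (at w)" by auto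
qed

lemma sym_zeta_0: "sym_zeta t 0 = 0"
  by (simp add: sym_zeta_def second_diff_def)

text \<open>
  The derivative of a term at \<open>0\<close> is \<open>- ln (1 - t\<^sup>2/k\<^sup>2)\<close>, so the partial sums are logarithms of the partial
  products of \<open>sin (\<pi>t) / (\<pi>t)\<close>.
\<close>

lemma deriv_sym_zeta_0:
  assumes t: "0 < t" "t < 1"
  shows "deriv (sym_zeta t) 0 = - of_real (ln (sin (pi * t) / (pi * t)))"
proof -
  have partial: "(\<Sum>n<N. second_diff' t n 0) = - of_real (ln (\<Prod>k=1..N. 1 - t^2 / (real k)^2))" for N
  proof -
    have pos: "1 - t^2 / (real k)^2 > 0" if "k \<ge> 1" for k
    proof -
      have "t^2 < 1^2" using t by (intro power_strict_mono) auto
      also have "1^2 \<le> (real k)^2" using that by (intro power_mono) auto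
      finally show ?thesis using that by simp
    qed
    have single: "second_diff' t n 0 = - of_real (ln (1 - t^2 / (real (Suc n))^2))" for n
    proof -
      have "1 - t^2 / (real (Suc n))^2 = (real n + 1 + t) * (real n + 1 - t) / ((real n + 1) * (real n + 1))"
      proof -
        have "real n + 1 \<noteq> 0" by linarith
        then show ?thesis by (simp add: divide_simps power2_eq_square) (simp add: algebra_simps)
      qed
      then have "ln (1 - t^2 / (real (Suc n))^2) = ln (real n + 1 + t) + ln (real n + 1 - t) - 2 * ln (real n + 1)"
        using t by (simp add: ln_mult ln_div)
      then show ?thesis by (simp add: second_diff'_def)
    qed
    have "(\<Sum>n<N. second_diff' t n 0) = - of_real (\<Sum>n<N. ln (1 - t^2 / (real (Suc n))^2))"
      by (simp add: single sum_negf)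
    also have "(\<Sum>n<N. ln (1 - t^2 / (real (Suc n))^2)) = (\<Sum>k=1..N. ln (1 - t^2 / (real k)^2))"
      by (rule sum.reindex_bij_witness[of _ "\<lambda>k. k - 1" Suc]) auto
    also have "\<dots> = ln (\<Prod>k=1..N. 1 - t^2 / (real k)^2)"
    proof (rule ln_prod[symmetric])
      show "1 - t^2 / (real k)^2 \<noteq> 0" if "k \<in> {1..N}" for k using pos[of k] that by simp
    qed simp
    finally show ?thesis .
  qed
  have "sin (pi * t) > 0" using t by (intro sin_gt_zero) auto
  then have "(\<lambda>N. ln (\<Prod>k=1..N. 1 - t^2 / (real k)^2)) \<longlonglongrightarrow> ln (sin (pi * t) / (pi * t))"
    using t by (intro tendsto_ln sin_product_formula_real') auto
  then have "(\<lambda>N. \<Sum>n<N. second_diff' t n 0) \<longlonglongrightarrow> - of_real (ln (sin (pi * t) / (pi * t)))"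
    unfolding partial by (intro tendsto_minus tendsto_of_real)
  moreover have "(\<lambda>n. second_diff' t n 0) sums deriv (sym_zeta t) 0"
    using t by (intro sym_zeta_sums_and_derivative(2)) auto
  ultimately show ?thesis unfolding sums_def using LIMSEQ_unique by blast
qed

text \<open>
  For \<open>Re w > 1\<close>, summing \<open>(n + 1/2)\<^sup>-\<^sup>w\<close> amounts to summing over odd integers, and \<open>sym_zeta (1/2) w\<close> becomes
  \<open>(2\<^sup>w\<^sup>+\<^sup>1 - 4) \<zeta>(w) - 2\<^sup>w\<close>.  Solved for \<open>\<zeta>(w)\<close>, this continues the Riemann zeta function past \<open>0\<close>.
\<close>

definition riemann_zeta :: "complex \<Rightarrow> complex" where
  "riemann_zeta w = (sym_zeta (1/2) w + pow_term (1/2) w) / (2 * pow_term (1/2) w - 4)"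

lemma pow_term_summable:
  assumes w: "Re w > 1" and c: "c > 0"
  shows "summable (\<lambda>n. norm (pow_term (real n + c) w))"
proof (rule summable_comparison_test_ev)
  show "summable (\<lambda>n. real n powr (- Re w))" using w by (simp add: summable_real_powr_iff)
  show "\<forall>\<^sub>F n in sequentially. norm (norm (pow_term (real n + c) w)) \<le> real n powr (- Re w)"
    unfolding eventually_sequentially
    using w c by (intro exI[of _ 1]) (auto simp: norm_pow_term intro!: powr_mono2')
qed

lemma riemann_zeta_sums:
  assumes w: "Re w > 1"
  shows "(\<lambda>n. pow_term (real n + 1) w) sums riemann_zeta w"
proof -
  define a where "a n = pow_term (real n + 1) w" for n
  define P where "P = pow_term (1/2) w"
  have summ: "summable (\<lambda>n. pow_term (real n + c) w)" if "c > 0" for c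
    using pow_term_summable[OF w that] by (rule summable_norm_cancel)
  define Z where "Z = suminf a"
  have a: "a sums Z" unfolding Z_def a_def using summ[of 1] by (simp add: summable_sums)
  have PP: "P * pow_term 2 w = 1"
    using pow_term_mult[of "1/2" 2 w] by (simp add: P_def pow_term_def)
  \<comment> \<open>The even terms sum to \<open>2\<^sup>-\<^sup>w Z\<close>, hence the odd ones to \<open>(1 - 2\<^sup>-\<^sup>w) Z\<close>.\<close>
  have "a (2 * n + 1) = pow_term 2 w * a n" for n
    using pow_term_mult[of 2 "real n + 1" w] by (simp add: a_def algebra_simps)
  then have even: "(\<lambda>n. a (2 * n + 1)) sums (pow_term 2 w * Z)"
    using sums_mult[OF a, of "pow_term 2 w"] by simp
  have "(\<lambda>n. sum a {n * 2..<n * 2 + 2}) sums Z" by (rule sums_group[OF a]) simp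
  moreover have "sum a {n * 2..<n * 2 + 2} = a (2 * n) + a (2 * n + 1)" for n
    by (simp add: numeral_2_eq_2 mult.commute)
  ultimately have "(\<lambda>n. a (2 * n) + a (2 * n + 1)) sums Z" by simp
  from sums_diff[OF this even] have odd: "(\<lambda>n. a (2 * n)) sums (Z - pow_term 2 w * Z)" by simp
  have half: "pow_term (real n + 1/2) w = P * a (2 * n)" for n
    using pow_term_mult[of "1/2" "2 * real n + 1" w] by (simp add: a_def P_def algebra_simps)
  have "P * (Z - pow_term 2 w * Z) = (P - 1) * Z"
  proof -
    have "P * (Z - pow_term 2 w * Z) = P * Z - (P * pow_term 2 w) * Z" by (simp add: right_diff_distrib mult.assoc)
    then show ?thesis by (simp add: PP left_diff_distrib)
  qed
  then have h1: "(\<lambda>n. pow_term (real n + 1/2) w) sums ((P - 1) * Z)"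
    using sums_mult[OF odd, of P] by (simp add: half)
  then have h2: "(\<lambda>n. pow_term (real (Suc n) + 1/2) w) sums ((P - 1) * Z - P)"
    using sums_Suc_iff[of "\<lambda>n. pow_term (real n + 1/2) w" "(P - 1) * Z - P"] by (simp add: P_def)
  have "(\<lambda>n. pow_term (real (Suc n) + 1/2) w + pow_term (real n + 1/2) w - 2 * a n)
      sums (((P - 1) * Z - P) + (P - 1) * Z - 2 * Z)"
    by (intro sums_add sums_diff sums_mult h1 h2 a)
  then have "(\<lambda>n. second_diff (1/2) n w) sums ((2 * P - 4) * Z - P)"
    by (simp add: second_diff_def a_def algebra_simps)
  then have "sym_zeta (1/2) w = (2 * P - 4) * Z - P" by (simp add: sym_zeta_def sums_iff)
  moreover have "2 * P - 4 \<noteq> 0"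
  proof
    assume "2 * P - 4 = 0"
    then have "norm P = 2" by (simp add: eq_diff_eq[symmetric])
    moreover have "norm P = 2 powr (Re w)" unfolding P_def by (subst norm_pow_term) (auto simp: powr_minus powr_divide)
    moreover have "2 powr (Re w) > (2::real) powr 1" using w by (intro powr_less_mono) auto
    ultimately show False by simp
  qed
  ultimately have "riemann_zeta w = Z" by (simp add: riemann_zeta_def flip: P_def)
  then show ?thesis using a unfolding a_def[abs_def] by simp
qed

text \<open>
  The three summands come from \<open>\<nu> = 0\<close>, from the deviation of \<open>\<bar>\<nu> + t\<bar>\<^sup>-\<^sup>w\<close> from \<open>\<bar>\<nu>\<bar>\<^sup>-\<^sup>w\<close> for the pairs \<open>\<plusminus>\<nu>\<close>, and
  from \<open>\<bar>\<nu>\<bar>\<^sup>-\<^sup>w\<close> itself.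
\<close>

definition lattice_zeta :: "real \<Rightarrow> complex \<Rightarrow> complex" where
  "lattice_zeta t w = pow_term t w + sym_zeta t w + 2 * riemann_zeta w"

lemma lattice_zeta_has_sum:
  assumes t: "0 < t" "t < 1" and w: "Re w > 1"
  shows "((\<lambda>\<nu>::int. pow_term \<bar>of_int \<nu> + t\<bar> w) has_sum lattice_zeta t w) UNIV"
proof -
  let ?f = "\<lambda>\<nu>::int. pow_term \<bar>of_int \<nu> + t\<bar> w"
  have s: "(\<lambda>n. pow_term (real n + c) w) sums (\<Sum>n. pow_term (real n + c) w)" if "c > 0" for c
    using pow_term_summable[OF w that] by (simp add: summable_norm_cancel summable_sums)
  define A where "A = (\<Sum>n. pow_term (real n + (1 + t)) w)"
  define B where "B = (\<Sum>n. pow_term (real n + (1 - t)) w)"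
  have sA: "(\<lambda>n. pow_term (real n + (1 + t)) w) sums A" and sB: "(\<lambda>n. pow_term (real n + (1 - t)) w) sums B"
    unfolding A_def B_def using t by (intro s; simp)+
  have hA: "((\<lambda>n. pow_term (real n + (1 + t)) w) has_sum A) UNIV"
    and hB: "((\<lambda>n. pow_term (real n + (1 - t)) w) has_sum B) UNIV"
    using t by (intro norm_summable_imp_has_sum pow_term_summable[OF w] sA sB; simp)+
  have "(\<lambda>n. second_diff t n w) sums (A + B - 2 * riemann_zeta w)"
    using sums_diff[OF sums_add[OF sA sB] sums_mult[OF riemann_zeta_sums[OF w], of 2]]
    by (simp add: second_diff_def add.assoc diff_add_eq add_diff_eq)
  then have AB: "A + B = sym_zeta t w + 2 * riemann_zeta w"
    by (simp add: sym_zeta_def sums_iff)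
  have "(?f has_sum A) (range (\<lambda>n. int n + 1))"
    by (subst has_sum_reindex) (use hA t in \<open>auto simp: inj_on_def o_def add.assoc\<close>)
  moreover have "(?f has_sum B) (range (\<lambda>n. - int n - 1))"
  proof (subst has_sum_reindex)
    have "\<bar>of_int (- int n - 1) + t\<bar> = real n + (1 - t)" for n using t by simp
    then show "(?f \<circ> (\<lambda>n. - int n - 1) has_sum B) UNIV" using hB by (simp add: o_def)
  qed (auto simp: inj_on_def)
  ultimately have "(?f has_sum (A + B)) (range (\<lambda>n. int n + 1) \<union> range (\<lambda>n. - int n - 1))"
    by (rule has_sum_Un_disjoint) auto
  moreover have "(?f has_sum (pow_term t w)) {0}" using t by (simp add: has_sum_finite_iff)
  ultimately have "(?f has_sum (A + B + pow_term t w)) ((range (\<lambda>n. int n + 1) \<union> range (\<lambda>n. - int n - 1)) \<union> {0})"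
    by (rule has_sum_Un_disjoint) auto
  moreover have "(range (\<lambda>n. int n + 1) \<union> range (\<lambda>n. - int n - 1)) \<union> {0} = UNIV"
  proof -
    have "x \<in> range (\<lambda>n. int n + 1) \<union> range (\<lambda>n. - int n - 1) \<union> {0}" for x :: int
    proof (cases x "0::int" rule: linorder_cases)
      case less
      then have "x = - int (nat (- x - 1)) - 1" by simp
      then show ?thesis by blast
    next
      case greater
      then have "x = int (nat (x - 1)) + 1" by simp
      then show ?thesis by blast
    qed simp
    then show ?thesis by blast
  qed
  ultimately show ?thesis using AB by (simp add: lattice_zeta_def add_ac)
qed

lemma sym_zeta_analytic:
  assumes "0 \<le> t" "t \<le> 1"
  shows "sym_zeta t analytic_on {w. Re w > -1/2}"
  unfolding analytic_on_open[OF open_halfspace_Re_gt]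
  using sym_zeta_sums_and_derivative(3)[OF assms]
  by (auto simp: holomorphic_on_open[OF open_halfspace_Re_gt])

lemma pow_term_analytic: "pow_term x analytic_on S"
  unfolding pow_term_def[abs_def] by (intro analytic_intros)

lemma lattice_zeta_meromorphic:
  assumes "0 \<le> t" "t \<le> 1"
  shows "lattice_zeta t meromorphic_on {w. Re w > -1/2}"
  unfolding lattice_zeta_def[abs_def] riemann_zeta_def
  by (intro meromorphic_intros analytic_on_imp_meromorphic_on sym_zeta_analytic pow_term_analytic) (use assms in auto)

lemma lattice_zeta_analytic_0:
  assumes "0 \<le> t" "t \<le> 1"
  shows "lattice_zeta t analytic_on {0}"
proof -
  have "sym_zeta u analytic_on {0}" if "0 \<le> u" "u \<le> 1" for u
    using sym_zeta_analytic[OF that] by (rule analytic_on_subset) auto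
  then show ?thesis unfolding lattice_zeta_def[abs_def] riemann_zeta_def
    using assms by (intro analytic_intros pow_term_analytic) auto
qed

text \<open>
  The value \<open>1 + 0 + 2 \<zeta>(0)\<close> with \<open>\<zeta>(0) = -1/2\<close>.
\<close>

lemma lattice_zeta_0: "lattice_zeta t 0 = 0"
  by (simp add: lattice_zeta_def riemann_zeta_def sym_zeta_0)

text \<open>
  The value \<open>- ln t - ln (sin (\<pi>t) / (\<pi>t)) + 2 \<zeta>'(0)\<close>, where \<open>\<zeta>'(0) = - ln (2\<pi>) / 2\<close> comes from the sine
  product at \<open>1/2\<close>.
\<close>

lemma lattice_zeta_has_derivative_0:
  assumes t: "0 < t" "t < 1"
  shows "(lattice_zeta t has_field_derivative - of_real (ln (2 * sin (pi * t)))) (at 0)"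
proof -
  have d: "(sym_zeta u has_field_derivative - of_real (ln (sin (pi * u) / (pi * u)))) (at 0)" if "0 < u" "u < 1" for u
    using sym_zeta_sums_and_derivative(3)[of u 0] deriv_sym_zeta_0[OF that] that by simp
  have h: "(sym_zeta (1/2) has_field_derivative of_real (ln (pi / 2))) (at 0)"
    using d[of "1/2"] by (simp add: ln_div)
  have "sin (pi * t) > 0" using t by (intro sin_gt_zero) auto
  then have ln: "ln (2 * sin (pi * t)) = ln 2 + ln (sin (pi * t))"
    "ln (sin (pi * t) / (pi * t)) = ln (sin (pi * t)) - ln pi - ln t" "ln (pi / 2) = ln pi - ln 2" "ln (1/2::real) = - ln 2"
    using t by (simp_all add: ln_mult ln_div)
  show ?thesis
    unfolding lattice_zeta_def[abs_def] riemann_zeta_def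
    by (rule derivative_eq_intros d h refl t | simp add: sym_zeta_0)+
      (simp add: ln field_simps)
qed

section \<open>Uniqueness of the continuation to zero\<close>

text \<open>
  Near each point a meromorphic function vanishes identically or nowhere on a punctured neighbourhood.  The
  first alternative is an open and closed condition, and the half plane is connected.
\<close>

lemma meromorphic_zero_on_half_plane:
  assumes d: "d meromorphic_on {s. Re s \<ge> 0}" and zero: "\<And>s. Re s > a \<Longrightarrow> d s = 0"
  shows "\<forall>\<^sub>F s in at 0. d s = 0"
proof -
  let ?A = "{s. Re s \<ge> 0}" and ?P = "\<lambda>z. \<forall>\<^sub>F s in at z. d s = 0"
  define p where "p = complex_of_real (max a 0 + 1)"
  have "connected ?A" by (intro convex_connected convex_halfspace_Re_ge)
  moreover have "p \<in> ?A" "0 \<in> ?A" by (auto simp: p_def)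
  moreover have "?P p"
    by (rule eventually_at_in_open'[THEN eventually_mono, of "{s. Re s > a}"])
      (auto simp: p_def open_halfspace_Re_gt zero)
  ultimately show "?P 0"
  proof (rule connected_induction_simple)
    fix z assume z: "z \<in> ?A"
    have iso: "isolated_singularity_at d z" "not_essential d z"
      using meromorphic_on_subset[OF d, of "{z}"] z by (auto simp: meromorphic_at_iff)
    have "?P z \<or> (\<forall>\<^sub>F s in at z. d s \<noteq> 0)"
      using not_essential_frequently_0_imp_eventually_0[OF iso] by (auto simp: frequently_def)
    then obtain S where S: "open S" "z \<in> S"
      "(\<forall>s\<in>S - {z}. d s = 0) \<or> (\<forall>s\<in>S - {z}. d s \<noteq> 0)"
      unfolding eventually_at_topological by blast
    have P: "\<forall>\<^sub>F s in at x. s \<in> S - {z}" if "x \<in> S" for x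
    proof (cases "x = z")
      case True
      then show ?thesis using eventually_at_in_open[OF S(1,2)] by simp
    next
      case False
      then show ?thesis using that S(1) by (intro eventually_at_in_open') auto
    qed
    have "?P x \<longleftrightarrow> (\<forall>s\<in>S - {z}. d s = 0)" if "x \<in> S" for x
      using S(3)
    proof
      assume *: "\<forall>s\<in>S - {z}. d s = 0"
      then show ?thesis using P[OF that] by (auto elim: eventually_mono)
    next
      assume *: "\<forall>s\<in>S - {z}. d s \<noteq> 0"
      have "\<not> ?P x"
      proof
        assume "?P x"
        with P[OF that] have "\<forall>\<^sub>F s in at x. False" by eventually_elim (use * in auto)
        then show False by simp
      qed
      moreover have "\<exists>s. s \<in> S - {z}"
        using eventually_happens[OF P[OF that]] by auto
      ultimately show ?thesis using * by blast
    qed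
    then show "\<exists>T. openin (top_of_set ?A) T \<and> z \<in> T \<and> (\<forall>x\<in>T. \<forall>y\<in>T. ?P x \<longrightarrow> ?P y)"
      using S(1,2) z by (intro exI[of _ "?A \<inter> S"]) auto
  qed
qed

lemma continuation_unique:
  assumes g: "is_continuation F g" and h: "is_continuation F h"
  shows "\<forall>\<^sub>F s in nhds 0. g s = h s"
proof -
  obtain a b where ab: "\<And>s. Re s > a \<Longrightarrow> g s = F s" "\<And>s. Re s > b \<Longrightarrow> h s = F s"
    using g h unfolding is_continuation_def by blast
  define d where "d = (\<lambda>s. g s - h s)"
  have "d meromorphic_on {s. Re s \<ge> 0}"
    using g h unfolding is_continuation_def d_def by (auto intro!: meromorphic_intros)
  then have ev: "\<forall>\<^sub>F s in at 0. d s = 0"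
    by (rule meromorphic_zero_on_half_plane[of _ "max a b"]) (simp add: d_def ab)
  have "d analytic_on {0}" using g h unfolding is_continuation_def d_def by (auto intro!: analytic_intros)
  then have "isCont d 0" using analytic_at_imp_isCont by blast
  then have "(d \<longlongrightarrow> d 0) (at 0)" by (simp add: isCont_def)
  moreover have "(d \<longlongrightarrow> 0) (at 0)" using ev by (rule tendsto_eventually)
  ultimately have "d 0 = 0" using tendsto_unique[of "at (0::complex)"] by auto
  then have "\<forall>\<^sub>F s in nhds 0. d s = 0" using ev by (simp add: eventually_nhds_conv_at)
  then show ?thesis by (simp add: d_def)
qed

lemma is_continuation_continuation:
  assumes "is_continuation F g" shows "is_continuation F (continuation F)"
  using someI_ex[of "is_continuation F"] assms by (auto simp: continuation_def)

lemma deriv_continuation: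
  assumes "is_continuation F g" shows "deriv (continuation F) 0 = deriv g 0"
  by (rule deriv_cong_ev[OF continuation_unique[OF is_continuation_continuation[OF assms] assms] refl])

lemma is_continuation_cmult:
  assumes "is_continuation F g" shows "is_continuation (\<lambda>s. c * F s) (\<lambda>s. c * g s)"
  using assms unfolding is_continuation_def
  by (auto intro!: meromorphic_intros analytic_intros)

text \<open>
  Homogeneity holds whether or not a continuation exists, because for \<open>c \<noteq> 0\<close> the two functions are
  continuable together.  This lets the weights of the degrees be summed for lattices of any rank.
\<close>

lemma continuation_cmult:
  assumes c: "c \<noteq> 0"
  shows "\<forall>\<^sub>F s in nhds 0. continuation (\<lambda>s. c * F s) s = c * continuation F s"
proof (cases "\<exists>g. is_continuation F g")
  case True
  then have "is_continuation F (continuation F)" using is_continuation_continuation by blast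
  from is_continuation_cmult[OF this] have *: "is_continuation (\<lambda>s. c * F s) (\<lambda>s. c * continuation F s)" .
  show ?thesis by (rule continuation_unique[OF is_continuation_continuation[OF *] *])
next
  case False
  have "\<nexists>g. is_continuation (\<lambda>s. c * F s) g"
  proof
    assume "\<exists>g. is_continuation (\<lambda>s. c * F s) g"
    then obtain g where "is_continuation (\<lambda>s. c * F s) g" ..
    from is_continuation_cmult[OF this, of "inverse c"] False c show False
      by (simp add: mult.assoc[symmetric])
  qed
  with False show ?thesis by (simp add: continuation_def)
qed

lemma continuation_analytic_0: "continuation F analytic_on {0}"
proof (cases "\<exists>g. is_continuation F g")
  case True
  then show ?thesis using is_continuation_continuation unfolding is_continuation_def by blast
qed (simp add: continuation_def)

section \<open>Reduction of the twisted Laplacian to functions\<close>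

definition degree_weight :: "nat \<Rightarrow> complex" where
  "degree_weight n = (\<Sum>q\<le>n. (- 1) ^ q * of_nat q * of_nat (n choose q))"

lemma degree_weight: "degree_weight n = (if n = 1 then -1 else 0)"
proof (cases "n = 1")
  case False
  then show ?thesis using choose_alternating_linear_sum[OF False, where 'a=complex] by (simp add: degree_weight_def)
qed (simp add: degree_weight_def)

definition twisted_eigenfunctions ::
  "'a::euclidean_space set \<Rightarrow> ('a \<Rightarrow> int ^ 'n) \<Rightarrow> real ^ 'n \<Rightarrow> real \<Rightarrow> ('a \<Rightarrow> complex) set" where
  "twisted_eigenfunctions \<Gamma> \<phi> \<alpha> \<mu> = {f. smooth f \<and> (\<forall>\<gamma>\<in>\<Gamma>. \<forall>x. f (\<gamma> + x) = char_\<Gamma> \<phi> \<alpha> \<gamma> * f x) \<and>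
     scalar_laplacian f = (\<lambda>x. of_real \<mu> * f x)}"

lemma scalar_laplacian_add:
  assumes "smooth f" "smooth g"
  shows "scalar_laplacian (\<lambda>x. f x + g x) = (\<lambda>x. scalar_laplacian f x + scalar_laplacian g x)"
  using assms unfolding scalar_laplacian_def[abs_def]
  by (simp add: dir_deriv_add smooth_differentiable smooth_dir_deriv sum.distrib)

lemma scalar_laplacian_cmult:
  assumes "smooth f"
  shows "scalar_laplacian (\<lambda>x. c * f x) = (\<lambda>x. c * scalar_laplacian f x)"
  using assms unfolding scalar_laplacian_def[abs_def]
  by (simp add: dir_deriv_cmult smooth_differentiable smooth_dir_deriv sum_distrib_left)

lemma twisted_eigenfunctions_subspace: "func.subspace (twisted_eigenfunctions \<Gamma> \<phi> \<alpha> \<mu>)"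
  unfolding func.subspace_def
proof (intro conjI ballI allI)
  show "0 \<in> twisted_eigenfunctions \<Gamma> \<phi> \<alpha> \<mu>"
    using smooth_const[of 0] by (simp add: twisted_eigenfunctions_def zero_fun_def scalar_laplacian_def[abs_def])
next
  fix f g assume "f \<in> twisted_eigenfunctions \<Gamma> \<phi> \<alpha> \<mu>" "g \<in> twisted_eigenfunctions \<Gamma> \<phi> \<alpha> \<mu>"
  then show "f + g \<in> twisted_eigenfunctions \<Gamma> \<phi> \<alpha> \<mu>"
    by (simp add: twisted_eigenfunctions_def plus_fun_def smooth_add scalar_laplacian_add ring_distribs)
next
  fix c f assume "f \<in> twisted_eigenfunctions \<Gamma> \<phi> \<alpha> \<mu>"
  then show "fun_scale c f \<in> twisted_eigenfunctions \<Gamma> \<phi> \<alpha> \<mu>"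
    by (simp add: twisted_eigenfunctions_def fun_scale_def smooth_cmult scalar_laplacian_cmult mult_ac)
qed

text \<open>
  Equivariance, smoothness and the eigenvalue equation are all conditions on the individual coefficients.
\<close>

lemma eigenspace_twisted_forms:
  "eigenspace form_scale (twisted_forms \<Gamma> \<phi> \<alpha> q) hodge_laplacian \<mu> =
     forms_with_coeffs q (twisted_eigenfunctions \<Gamma> \<phi> \<alpha> \<mu>)"
proof (intro set_eqI iffI)
  fix \<omega> assume *: "\<omega> \<in> eigenspace form_scale (twisted_forms \<Gamma> \<phi> \<alpha> q) hodge_laplacian \<mu>"
  then have sm: "smooth (\<lambda>x. \<omega> x vs)" for vs
    by (auto simp: eigenspace_def twisted_forms_def smooth_forms_def)
  have "hodge_laplacian \<omega> = form_scale (complex_of_real \<mu>) \<omega>" using * by (simp add: eigenspace_def)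
  then have "hodge_laplacian \<omega> x vs = of_real \<mu> * \<omega> x vs" for x vs by (simp add: form_scale_def)
  then have "scalar_laplacian (\<lambda>x. \<omega> x vs) x = of_real \<mu> * \<omega> x vs" for x vs
    by (simp only: hodge_laplacian_eq_scalar_laplacian[OF sm])
  then show "\<omega> \<in> forms_with_coeffs q (twisted_eigenfunctions \<Gamma> \<phi> \<alpha> \<mu>)"
    using * by (auto simp: eigenspace_def twisted_forms_def smooth_forms_def forms_with_coeffs_def
        twisted_eigenfunctions_def covector_scale_def)
next
  fix \<omega> assume *: "\<omega> \<in> forms_with_coeffs q (twisted_eigenfunctions \<Gamma> \<phi> \<alpha> \<mu>)"
  then have sm: "smooth (\<lambda>x. \<omega> x vs)" for vs
    by (auto simp: forms_with_coeffs_def twisted_eigenfunctions_def)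
  have "scalar_laplacian (\<lambda>x. \<omega> x vs) = (\<lambda>x. of_real \<mu> * \<omega> x vs)" for vs
    using * by (auto simp: forms_with_coeffs_def twisted_eigenfunctions_def)
  then have "hodge_laplacian \<omega> = form_scale (complex_of_real \<mu>) \<omega>"
    by (intro ext) (simp add: hodge_laplacian_eq_scalar_laplacian[OF sm] form_scale_def)
  then show "\<omega> \<in> eigenspace form_scale (twisted_forms \<Gamma> \<phi> \<alpha> q) hodge_laplacian \<mu>"
    using * by (auto simp: eigenspace_def twisted_forms_def smooth_forms_def forms_with_coeffs_def
        twisted_eigenfunctions_def covector_scale_def fun_eq_iff)
qed

definition function_zeta ::
  "'a::euclidean_space set \<Rightarrow> ('a \<Rightarrow> int ^ 'n) \<Rightarrow> real ^ 'n \<Rightarrow> complex \<Rightarrow> complex" where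
  "function_zeta \<Gamma> \<phi> \<alpha> s = (\<Sum>\<^sub>\<infinity>\<mu>\<in>{\<mu>. \<exists>f\<in>twisted_eigenfunctions \<Gamma> \<phi> \<alpha> \<mu>. f \<noteq> 0} - {0}.
     of_nat (func.dim (twisted_eigenfunctions \<Gamma> \<phi> \<alpha> \<mu>)) * complex_of_real \<mu> powr (- s))"

lemma twisted_zeta_eq:
  fixes \<Gamma> :: "'a::euclidean_space set"
  assumes q: "q \<le> DIM('a)"
  shows "twisted_zeta \<Gamma> \<phi> \<alpha> q = (\<lambda>s. of_nat (DIM('a) choose q) * function_zeta \<Gamma> \<phi> \<alpha> s)"
proof
  fix s
  have spec: "twisted_spectrum \<Gamma> \<phi> \<alpha> q = {\<mu>. \<exists>f\<in>twisted_eigenfunctions \<Gamma> \<phi> \<alpha> \<mu>. f \<noteq> 0}"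
    unfolding twisted_spectrum_def spectrum_def eigenspace_twisted_forms
    using forms_with_coeffs_nonzero_iff[OF twisted_eigenfunctions_subspace[of \<Gamma> \<phi> \<alpha>] q] by auto
  show "twisted_zeta \<Gamma> \<phi> \<alpha> q s = of_nat (DIM('a) choose q) * function_zeta \<Gamma> \<phi> \<alpha> s"
    unfolding twisted_zeta_def function_zeta_def spec eigen_multiplicity_def eigenspace_twisted_forms
      dim_forms_with_coeffs[OF twisted_eigenfunctions_subspace] infsum_cmult_right'[symmetric]
    by (simp add: mult.assoc)
qed

lemma analytic_torsion_eq:
  fixes \<Gamma> :: "'a::euclidean_space set"
  shows "analytic_torsion \<Gamma> \<phi> \<alpha> = degree_weight (DIM('a)) * deriv (continuation (function_zeta \<Gamma> \<phi> \<alpha>)) 0"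
proof -
  let ?Z = "function_zeta \<Gamma> \<phi> \<alpha>" and ?n = "DIM('a)"
  have "\<forall>\<^sub>F s in nhds 0. \<forall>q\<in>{..?n}. continuation (twisted_zeta \<Gamma> \<phi> \<alpha> q) s = of_nat (?n choose q) * continuation ?Z s"
    by (intro eventually_ball_finite ballI) (auto simp: twisted_zeta_eq intro: continuation_cmult)
  then have "\<forall>\<^sub>F s in nhds 0. (\<Sum>q\<le>?n. (- 1) ^ q * of_nat q * continuation (twisted_zeta \<Gamma> \<phi> \<alpha> q) s) =
      degree_weight ?n * continuation ?Z s"
    by eventually_elim (simp add: degree_weight_def sum_distrib_right mult.assoc)
  then have "analytic_torsion \<Gamma> \<phi> \<alpha> = deriv (\<lambda>s. degree_weight ?n * continuation ?Z s) 0"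
    unfolding analytic_torsion_def by (rule deriv_cong_ev) simp
  also have "\<dots> = degree_weight ?n * deriv (continuation ?Z) 0"
    by (intro deriv_cmult analytic_on_imp_differentiable_at[OF continuation_analytic_0]) simp
  finally show ?thesis .
qed

section \<open>The localised Laplacian\<close>

lemma scalar_laplacian_char_G:
  "scalar_laplacian (char_G h) = (\<lambda>x. of_real (4 * pi\<^sup>2 * (h \<bullet> h)) * char_G h x)"
proof
  fix x
  have "scalar_laplacian (char_G h) x = - (\<Sum>b\<in>Basis. (2 * of_real pi * \<i> * of_real (h \<bullet> b))\<^sup>2 * char_G h x)"
    unfolding scalar_laplacian_def
    by (simp add: dir_deriv_char_G dir_deriv_cmult smooth_differentiable smooth_char_G power2_eq_square mult.assoc)
  also have "\<dots> = (\<Sum>b\<in>Basis. of_real (4 * pi\<^sup>2 * (h \<bullet> b)\<^sup>2) * char_G h x)"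
    by (simp add: sum_negf[symmetric] power_mult_distrib)
  also have "\<dots> = of_real (4 * pi\<^sup>2 * (\<Sum>b\<in>Basis. (h \<bullet> b)\<^sup>2)) * char_G h x"
    by (simp add: sum_distrib_left sum_distrib_right)
  also have "(\<Sum>b\<in>Basis. (h \<bullet> b)\<^sup>2) = h \<bullet> h"
    by (subst euclidean_inner) (simp add: power2_eq_square)
  finally show "scalar_laplacian (char_G h) x = of_real (4 * pi\<^sup>2 * (h \<bullet> h)) * char_G h x" .
qed

text \<open>
  The character \<open>\<chi>\<^sub>h\<close> is an eigenfunction of the scalar Laplacian, and \<open>\<chi>\<^sub>h(0) = 1\<close>.
\<close>

lemma localised_laplacian_eq:
  "localised_laplacian h \<eta> = covector_scale (of_real (4 * pi\<^sup>2 * (h \<bullet> h))) \<eta>"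
proof
  fix vs
  have sm: "smooth (\<lambda>x. covector_scale (char_G h x) \<eta> us)" for us
    using smooth_cmult[OF smooth_char_G, of "\<eta> us"] by (simp add: covector_scale_def mult.commute)
  have "localised_laplacian h \<eta> vs = scalar_laplacian (\<lambda>x. \<eta> vs * char_G h x) 0"
    unfolding localised_laplacian_def hodge_laplacian_eq_scalar_laplacian[OF sm]
    by (simp add: covector_scale_def mult.commute)
  moreover have "char_G h 0 = 1" by (simp add: char_G_def)
  ultimately show "localised_laplacian h \<eta> vs = covector_scale (of_real (4 * pi\<^sup>2 * (h \<bullet> h))) \<eta> vs"
    by (simp add: scalar_laplacian_cmult[OF smooth_char_G] scalar_laplacian_char_G covector_scale_def)
qed

lemma local_eigenspace:
  "eigenspace covector_scale (covectors q) (localised_laplacian h) \<mu> =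
     (if \<mu> = 4 * pi\<^sup>2 * (h \<bullet> h) then covectors q else {0})"
proof -
  have "covector_scale (of_real x) \<eta> = covector_scale (of_real y) \<eta> \<longleftrightarrow> x = y \<or> \<eta> = 0" for x y :: real and \<eta> :: "'a covector"
    by (auto simp: covector_scale_def fun_eq_iff)
  moreover have "0 \<in> covectors q" using covectors_subspace covector.subspace_0 by blast
  ultimately show ?thesis unfolding eigenspace_def localised_laplacian_eq by (auto simp del: of_real_mult)
qed

lemma local_spectrum_eq:
  fixes h :: "'a::euclidean_space"
  assumes q: "q \<le> DIM('a)"
  shows "local_spectrum q h = {4 * pi\<^sup>2 * (h \<bullet> h)}"
proof -
  obtain S :: "'a set" where S: "S \<in> basis_subsets q" using basis_subsets_nonempty[OF q] by blast
  have "basis_covector S \<noteq> 0" using basis_covector_dual[OF S S] by (metis zero_fun_apply zero_neq_one)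
  then have "\<exists>\<eta>\<in>covectors q. (\<eta> :: 'a covector) \<noteq> 0" using basis_covector_in_covectors[OF S] by blast
  then show ?thesis unfolding local_spectrum_def spectrum_def local_eigenspace by auto
qed

lemma local_zeta_eq:
  fixes h :: "'a::euclidean_space"
  assumes q: "q \<le> DIM('a)"
  shows "local_zeta q h s = (if h = 0 then 0 else of_nat (DIM('a) choose q) * pow_term (4 * pi\<^sup>2 * (h \<bullet> h)) s)"
proof (cases "h = 0")
  case True
  then have "{\<mu> \<in> local_spectrum q h. \<mu> > 0} = {}" using q by (simp add: local_spectrum_eq)
  then show ?thesis using True unfolding local_zeta_def by (simp only:) simp
next
  case False
  then have pos: "4 * pi\<^sup>2 * (h \<bullet> h) > 0" by simp
  then have "{\<mu> \<in> local_spectrum q h. \<mu> > 0} = {4 * pi\<^sup>2 * (h \<bullet> h)}" using q by (auto simp: local_spectrum_eq)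
  then show ?thesis unfolding local_zeta_def
    using False pos by (simp only:) (simp add: eigen_multiplicity_def local_eigenspace dim_covectors pow_term_eq_powr)
qed

lemma local_t_eq:
  fixes h :: "'a::euclidean_space"
  shows "local_t s h = (if h = 0 then 0 else degree_weight (DIM('a)) * pow_term (4 * pi\<^sup>2 * (h \<bullet> h)) s)"
  by (simp add: local_t_def local_zeta_eq degree_weight_def sum_distrib_right mult.assoc)

lemma local_torsion_eq:
  fixes h :: "'a::euclidean_space"
  assumes "h \<noteq> 0"
  shows "local_torsion h = - degree_weight (DIM('a)) * of_real (ln (4 * pi\<^sup>2 * (h \<bullet> h)))"
proof -
  have "((\<lambda>s. local_t s h) has_field_derivative - degree_weight (DIM('a)) * of_real (ln (4 * pi\<^sup>2 * (h \<bullet> h)))) (at 0)"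
    unfolding local_t_eq using assms by (simp only: if_False) (rule derivative_eq_intros refl | simp)+
  then show ?thesis unfolding local_torsion_def by (rule DERIV_imp_deriv)
qed

text \<open>
  Every \<open>\<Delta>\<^sup>(\<^sup>q\<^sup>)(h)\<close> with \<open>q \<le> n\<close> has the single eigenvalue \<open>4\<pi>\<^sup>2\<bar>h\<bar>\<^sup>2\<close>, so the condition excluded on this set is that
  there is room for some \<open>K\<^sub>h\<close> between \<open>K\<close> and that eigenvalue.
\<close>

lemma dual_G0_eq: "dual_G0 K = {h :: 'a::euclidean_space. 4 * pi\<^sup>2 * (h \<bullet> h) \<le> K}"
proof -
  have "(\<exists>K\<^sub>h>K. \<forall>q\<le>DIM('a). \<forall>\<mu>\<in>local_spectrum q h. \<mu> > K\<^sub>h) \<longleftrightarrow> 4 * pi\<^sup>2 * (h \<bullet> h) > K" for h :: 'a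
  proof
    assume "\<exists>K\<^sub>h>K. \<forall>q\<le>DIM('a). \<forall>\<mu>\<in>local_spectrum q h. \<mu> > K\<^sub>h"
    then show "4 * pi\<^sup>2 * (h \<bullet> h) > K" using local_spectrum_eq[of 0 h] by force
  next
    assume "4 * pi\<^sup>2 * (h \<bullet> h) > K"
    then obtain K' where "K' > K" "4 * pi\<^sup>2 * (h \<bullet> h) > K'" using dense by blast
    then show "\<exists>K\<^sub>h>K. \<forall>q\<le>DIM('a). \<forall>\<mu>\<in>local_spectrum q h. \<mu> > K\<^sub>h" by (auto simp: local_spectrum_eq)
  qed
  then show ?thesis unfolding dual_G0_def by (auto simp: not_less)
qed

section \<open>Logarithms, powers and the log-sine integral\<close>

text \<open>
  Henstock-Kurzweil integrals are available from antiderivatives; for functions of constant sign they give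
  Lebesgue integrals.
\<close>

lemma has_bochner_integral_nonneg_has_integral:
  fixes f :: "real \<Rightarrow> real"
  assumes "f \<in> borel_measurable borel" "\<And>x. f x \<ge> 0" "(f has_integral I) S" "\<And>x. x \<notin> S \<Longrightarrow> f x = 0"
  shows "has_bochner_integral lborel f I"
proof -
  have I: "(f has_integral I) UNIV"
    using assms(3,4) by (rule has_integral_on_superset) auto
  moreover have "0 \<le> I" by (rule has_integral_nonneg[OF I]) (simp add: assms)
  ultimately show ?thesis
    by (intro has_bochner_integral_nn_integral nn_integral_has_integral_lborel) (use assms in auto)
qed

text \<open>
  The antiderivative \<open>x ln x - x\<close> is continuous down to \<open>0\<close>, and \<open>ln r - ln x\<close> is nonnegative on the interval.
\<close>

lemma has_bochner_integral_ln:
  fixes r :: real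
  assumes r: "r > 0"
  shows "has_bochner_integral lborel (\<lambda>x. indicator {0<..r} x * ln x) (r * ln r - r)"
proof -
  define F where "F x = x * ln x - x" for x :: real
  have lim0: "((\<lambda>x::real. x * ln x) \<longlongrightarrow> 0) (at_right 0)"
  proof (rule Lim_null_comparison)
    show "\<forall>\<^sub>F x::real in at_right 0. norm (x * ln x) \<le> 2 * sqrt x"
    proof (rule eventually_at_rightI[of 0 1])
      fix x :: real assume x: "x \<in> {0<..<1}"
      \<comment> \<open>At \<open>y = 1 / x\<close> the inequality \<open>ln y \<le> y - 1\<close> would only bound \<open>x ln x\<close>; at \<open>y = 1 / sqrt x\<close> it leaves a factor \<open>sqrt x\<close>.\<close>
      have "- ln x = 2 * ln (inverse (sqrt x))" using x by (simp add: ln_inverse ln_sqrt)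
      also have "\<dots> \<le> 2 * inverse (sqrt x)"
        using ln_le_minus_one[of "inverse (sqrt x)"] x by simp
      finally have "x * (- ln x) \<le> x * (2 * inverse (sqrt x))" using x by (intro mult_left_mono) auto
      also have "x * (2 * inverse (sqrt x)) = 2 * sqrt x"
        using x by (simp add: field_simps)
      finally show "norm (x * ln x) \<le> 2 * sqrt x" using x by (simp add: abs_mult)
    qed simp
    show "((\<lambda>x. 2 * sqrt x) \<longlongrightarrow> 0) (at_right 0)"
      by (rule tendsto_eq_intros refl | simp)+
  qed
  have cont: "continuous_on {0..r} F"
    unfolding continuous_on_eq_continuous_within
  proof
    fix x assume "x \<in> {0..r}"
    show "continuous (at x within {0..r}) F"
    proof (cases "x = 0")
      case True
      have "(F \<longlongrightarrow> 0 - 0) (at_right 0)"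
        unfolding F_def by (intro tendsto_diff lim0) (auto intro: tendsto_eq_intros)
      moreover have "at 0 within {0..r} \<le> at_right (0::real)"
        unfolding at_within_def by (rule inf_mono) auto
      ultimately show ?thesis
        using tendsto_mono by (auto simp: True continuous_within F_def)
    next
      case False
      then show ?thesis using \<open>x \<in> {0..r}\<close> unfolding F_def by (auto intro!: continuous_intros)
    qed
  qed
  have "(F has_vector_derivative ln x) (at x)" if "x \<in> {0<..<r}" for x
    unfolding F_def using that
    by (auto intro!: derivative_eq_intros simp flip: has_real_derivative_iff_has_vector_derivative)
  from fundamental_theorem_of_calculus_interior[OF _ cont this]
  have "(ln has_integral (r * ln r - r)) {0..r}" using r by (simp add: F_def)
  from has_integral_diff[OF has_integral_const_real[of "ln r" 0 r] this]
  have "((\<lambda>x. ln r - ln x) has_integral r) {0..r}" using r by (simp add: mult.commute)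
  then have "((\<lambda>x. indicator {0<..r} x * (ln r - ln x)) has_integral r) {0..r}"
    by (rule has_integral_spike_finite[of "{0}", rotated 2]) (auto simp: indicator_def)
  then have "has_bochner_integral lborel (\<lambda>x. indicator {0<..r} x * (ln r - ln x)) r"
    by (rule has_bochner_integral_nonneg_has_integral[rotated 2]) (auto simp: indicator_def)
  moreover have "has_bochner_integral lborel (\<lambda>x. ln r * indicator {0<..r} x) (ln r * r)"
  proof -
    have "has_bochner_integral lborel (indicator {0<..r}) (measure lborel {0<..r})"
      by (rule has_bochner_integral_real_indicator) (use r in auto)
    then have "has_bochner_integral lborel (indicator {0<..r}) r" using r by simp
    then show ?thesis by (intro has_bochner_integral_mult_right)
  qed
  ultimately have "has_bochner_integral lborel
      (\<lambda>x. ln r * indicator {0<..r} x - indicator {0<..r} x * (ln r - ln x)) (ln r * r - r)"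
    by (intro has_bochner_integral_diff)
  moreover have "ln r * indicator {0<..r} x - indicator {0<..r} x * (ln r - ln x) = indicator {0<..r} x * ln x" for x
    by (simp add: algebra_simps)
  ultimately show ?thesis by (simp add: mult.commute)
qed

lemma pow_term_measurable [measurable]: "(\<lambda>x. pow_term x w) \<in> borel_measurable borel"
proof -
  have "(\<lambda>x::complex. exp (- (w * x))) \<in> borel_measurable borel"
    by (intro borel_measurable_continuous_onI continuous_intros)
  then show ?thesis unfolding pow_term_def[abs_def] by measurable
qed

lemma pow_term_has_vector_derivative:
  assumes "x > 0"
  shows "((\<lambda>x. pow_term x w) has_vector_derivative - (w / of_real x) * pow_term x w) (at x)"
proof -
  have "((\<lambda>x. - (w * complex_of_real (ln x))) has_vector_derivative - (w * of_real (1 / x))) (at x)"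
    using assms by (auto intro!: derivative_eq_intros has_vector_derivative_of_real simp: field_simps)
  from field_vector_diff_chain_at[OF this DERIV_exp]
  show ?thesis by (simp add: pow_term_def o_def field_simps)
qed

text \<open>
  Integrability comes from the real power \<open>x powr (- Re w)\<close> that bounds the integrand, the value from the
  antiderivative \<open>x\<^sup>1\<^sup>-\<^sup>w / (1 - w)\<close>, which vanishes at infinity.
\<close>

lemma has_bochner_integral_pow_term_tail:
  assumes r: "r > 0" and w: "Re w > 1"
  shows "has_bochner_integral lborel (\<lambda>x. indicator {r<..} x *\<^sub>R pow_term x w) (of_real r * pow_term r w / (w - 1))"
proof -
  have "((\<lambda>x. x powr (- Re w)) has_integral - (r powr (- Re w + 1)) / (- Re w + 1)) {r..}"
    using r w by (intro has_integral_powr_to_inf) auto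
  then have "((\<lambda>x. indicator {r..} x * x powr (- Re w)) has_integral - (r powr (- Re w + 1)) / (- Re w + 1)) {r..}"
    by (rule has_integral_eq[rotated]) (auto simp: indicator_def)
  then have "has_bochner_integral lborel (\<lambda>x. indicator {r..} x * x powr (- Re w)) (- (r powr (- Re w + 1)) / (- Re w + 1))"
    by (rule has_bochner_integral_nonneg_has_integral[rotated 2]) (auto simp: indicator_def)
  then have "integrable lborel (\<lambda>x. indicator {r..} x * x powr (- Re w))"
    by (simp add: has_bochner_integral_iff)
  then have int: "set_integrable lborel {r<..} (\<lambda>x. pow_term x w)"
    unfolding set_integrable_def
  proof (rule Bochner_Integration.integrable_bound)
    show "AE x in lborel. norm (indicator {r<..} x *\<^sub>R pow_term x w) \<le> norm (indicator {r..} x * x powr (- Re w))"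
      using r by (auto simp: indicator_def norm_pow_term)
  qed measurable
  define F where "F x = of_real x * pow_term x w / (1 - w)" for x
  have w1: "1 - w \<noteq> 0" using w by auto
  have der: "(F has_vector_derivative pow_term x w) (at x)" if "x > 0" for x
  proof -
    have "((\<lambda>x. of_real x * pow_term x w) has_vector_derivative
        (of_real x * (- (w / of_real x) * pow_term x w) + of_real 1 * pow_term x w)) (at x)"
      by (intro has_vector_derivative_mult has_vector_derivative_of_real pow_term_has_vector_derivative that
          DERIV_ident)
    from has_vector_derivative_divide[OF this, of "1 - w"]
    moreover have "(pow_term x w - w * pow_term x w) / (1 - w) = pow_term x w"
      using w1 by (simp add: field_simps)
    ultimately show ?thesis unfolding F_def using that by simp
  qed
  have "(LBINT x=ereal r..\<infinity>. pow_term x w) = 0 - F r"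
  proof (rule interval_integral_FTC_integrable)
    show "(F has_vector_derivative pow_term x w) (at x)" if "ereal r < ereal x" for x
      using that r by (intro der) auto
    show "isCont (\<lambda>x. pow_term x w) x" if "ereal r < ereal x" for x
      using that r pow_term_has_vector_derivative[of x w] has_vector_derivative_continuous by fastforce
    show "set_integrable lborel (einterval (ereal r) \<infinity>) (\<lambda>x. pow_term x w)"
      using int by (simp add: einterval_def greaterThan_def)
    have "isCont F r" using der[OF r] has_vector_derivative_continuous by blast
    then show "((F \<circ> real_of_ereal) \<longlongrightarrow> F r) (at_right (ereal r))"
      unfolding ereal_tendsto_simps by (simp add: isCont_def filterlim_at_split)
    show "((F \<circ> real_of_ereal) \<longlongrightarrow> 0) (at_left \<infinity>)"
      unfolding ereal_tendsto_simps
    proof (rule Lim_null_comparison)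
      show "\<forall>\<^sub>F x in at_top. norm (F x) \<le> x powr (- (Re w - 1)) / norm (1 - w)"
        using eventually_gt_at_top[of 0]
      proof eventually_elim
        case (elim x)
        have "x * x powr (- Re w) = x powr (- (Re w - 1))" using elim by (simp add: powr_diff powr_minus field_simps)
        then show ?case using elim by (simp add: F_def norm_mult norm_divide norm_pow_term)
      qed
      show "((\<lambda>x. x powr (- (Re w - 1)) / norm (1 - w)) \<longlongrightarrow> 0) at_top"
        using w by (intro tendsto_divide_zero tendsto_neg_powr filterlim_ident) auto
    qed
  qed simp
  also have "0 - F r = of_real r * pow_term r w / (w - 1)"
    unfolding F_def using w1 by (simp add: divide_simps) (simp add: algebra_simps)
  finally show ?thesis
    using int by (simp add: interval_integral_to_infinity_eq has_bochner_integral_iff set_integrable_def set_lebesgue_integral_def)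
qed

lemma has_bochner_integral_even_extension:
  fixes f :: "real \<Rightarrow> 'b::{banach, second_countable_topology}"
  assumes f: "has_bochner_integral lborel f I" and neg: "\<And>x. x \<le> 0 \<Longrightarrow> f x = 0"
  shows "has_bochner_integral lborel (\<lambda>x. f \<bar>x\<bar>) (I + I)"
proof -
  have "has_bochner_integral lborel (\<lambda>x. f (0 + (-1) * x)) (I /\<^sub>R \<bar>-1\<bar>)"
    using f by (subst lborel_has_bochner_integral_real_affine_iff[symmetric]) auto
  then have "has_bochner_integral lborel (\<lambda>x. f (- x)) I" by simp
  from has_bochner_integral_add[OF f this]
  have "has_bochner_integral lborel (\<lambda>x. f x + f (- x)) (I + I)" .
  moreover have "f x + f (- x) = f \<bar>x\<bar>" for x
    using neg[of x] neg[of "-x"] by (cases "x \<ge> 0") auto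
  ultimately show ?thesis by simp
qed

text \<open>
  From \<open>u cos u \<le> sin u\<close> with \<open>u = y / 2\<close> one gets \<open>sin y = 2 sin u cos u \<ge> y cos\<^sup>2 u = y (1 + cos y) / 2\<close>.
\<close>

lemma sin_ge_half:
  fixes y :: real
  assumes y: "0 \<le> y" "y \<le> pi / 2"
  shows "sin y \<ge> y / 2"
proof -
  define u where "u = y / 2"
  define f where "f u = sin u - u * cos u" for u :: real
  have "f 0 \<le> f u"
  proof (rule DERIV_nonneg_imp_nondecreasing[of 0 u])
    show "0 \<le> u" using y by (simp add: u_def)
  next
    fix x assume x: "0 \<le> x" "x \<le> u"
    have "(f has_real_derivative x * sin x) (at x)"
      unfolding f_def by (auto intro!: derivative_eq_intros simp: algebra_simps)
    moreover have "0 \<le> x * sin x"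
      using x y by (intro mult_nonneg_nonneg sin_ge_zero) (auto simp: u_def)
    ultimately show "\<exists>d. (f has_real_derivative d) (at x) \<and> 0 \<le> d" by blast
  qed
  then have su: "u * cos u \<le> sin u" by (simp add: f_def)
  have cu: "cos u \<ge> 0" using y by (intro cos_ge_zero) (auto simp: u_def)
  have cy: "cos y \<ge> 0" using y by (intro cos_ge_zero) auto
  have "y / 2 \<le> u * (1 + cos y)"
    using mult_nonneg_nonneg[OF y(1) cy] by (simp add: u_def algebra_simps)
  also have "1 + cos y = 2 * cos u * cos u"
    using cos_double_cos[of u] by (simp add: u_def power2_eq_square)
  also have "u * (2 * cos u * cos u) = 2 * ((u * cos u) * cos u)" by simp
  also have "\<dots> \<le> 2 * (sin u * cos u)" using su cu by (intro mult_left_mono mult_right_mono) auto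
  also have "\<dots> = sin y" using sin_double[of u] by (simp add: u_def)
  finally show ?thesis .
qed

text \<open>
  Let \<open>J\<close> be the integral over \<open>(0, 1/2)\<close>.  By symmetry the whole integral is \<open>2J\<close>, so after the substitution
  \<open>x \<mapsto> 2x\<close> it is \<open>J\<close>; the duplication formula says that the substituted integrand integrates to \<open>2J\<close>.
\<close>

lemma log_sine_integral:
  "has_bochner_integral lborel (\<lambda>x. indicator {0<..<1} x * ln (2 * sin (pi * x))) 0"
proof -
  define L where "L x = ln (2 * sin (pi * x))" for x
  define g where "g x = indicator {0<..<1} x * L x" for x
  define g1 where "g1 x = indicator {0<..<1/2} x * L x" for x
  have [measurable]: "L \<in> borel_measurable borel" unfolding L_def[abs_def] by measurable
  have [measurable]: "g \<in> borel_measurable borel" "g1 \<in> borel_measurable borel"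
    unfolding g_def[abs_def] g1_def[abs_def] by measurable
  have "integrable lborel g1"
  proof (rule Bochner_Integration.integrable_bound)
    have "integrable lborel (\<lambda>x. indicator {0<..1/2} x * ln (x::real))"
      using has_bochner_integral_ln[of "1/2"] by (simp add: has_bochner_integral_iff)
    moreover have "integrable lborel (\<lambda>x::real. ln (2::real) * indicator {0<..1/2} x)"
      by (intro integrable_mult_right integrable_real_indicator) 
      (auto intro!: emeasure_bounded_finite[unfolded infinity_ennreal_def] simp del: emeasure_lborel_Ioc)
    ultimately show "integrable lborel (\<lambda>x::real. ln (2::real) * indicator {0<..1/2} x - indicator {0<..1/2} x * ln x)"
      by (intro Bochner_Integration.integrable_diff)
    \<comment> \<open>Since \<open>x \<le> 2 sin (\<pi>x) \<le> 2\<close>, the only singularity is the integrable one of \<open>ln x\<close> at \<open>0\<close>.\<close>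
    have "norm (L x) \<le> ln 2 - ln x" if x: "0 < x" "x < 1/2" for x
    proof -
      have px: "0 < pi * x" "pi * x \<le> pi / 2" using x by auto
      have "x \<le> pi * x" using x pi_gt3 by (simp add: mult_le_cancel_right1)
      also have "\<dots> \<le> 2 * sin (pi * x)" using sin_ge_half[of "pi * x"] px by simp
      finally have lower: "x \<le> 2 * sin (pi * x)" .
      then have "ln x \<le> L x" unfolding L_def using x by (intro ln_mono) auto
      moreover have "L x \<le> ln 2"
        unfolding L_def using lower x by (intro ln_mono) auto
      moreover have "ln x \<le> 0" "0 \<le> ln (2::real)" using x by auto
      ultimately show ?thesis unfolding real_norm_def by linarith
    qed
    then show "AE x in lborel. norm (g1 x) \<le> norm (ln 2 * indicator {0<..1/2} x - indicator {0<..1/2} x * ln x)"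
      by (intro AE_I2) (auto simp: g1_def indicator_def)
  qed measurable
  then obtain J where J: "has_bochner_integral lborel g1 J"
    by (auto simp: has_bochner_integral_iff)
  \<comment> \<open>Symmetry about \<open>1/2\<close>: the two halves of the interval contribute the same.\<close>
  have "has_bochner_integral lborel (\<lambda>x. g1 (1 + (-1) * x)) (J /\<^sub>R \<bar>-1\<bar>)"
    using J by (subst lborel_has_bochner_integral_real_affine_iff[symmetric]) auto
  then have J2: "has_bochner_integral lborel (\<lambda>x. g1 (1 - x)) J" by simp
  have sym: "L (1 - x) = L x" for x
    by (simp add: L_def right_diff_distrib)
  have g: "has_bochner_integral lborel g (J + J)"
  proof (subst has_bochner_integral_cong_AE)
    show "has_bochner_integral lborel (\<lambda>x. g1 x + g1 (1 - x)) (J + J)"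
      by (rule has_bochner_integral_add[OF J J2])
    have "g x = g1 x + g1 (1 - x)" if "x \<noteq> 1/2" for x
      using that by (auto simp: g_def g1_def sym indicator_def)
    then show "AE x in lborel. g x = g1 x + g1 (1 - x)"
      using AE_lborel_singleton[of "1/2::real"] by (auto elim: eventually_mono)
  qed measurable
  \<comment> \<open>The duplication formula \<open>2 sin 2y = (2 sin y) (2 cos y)\<close> expresses \<open>g (2x)\<close> through the two halves.\<close>
  have "has_bochner_integral lborel (\<lambda>x. g (0 + 2 * x)) ((J + J) /\<^sub>R \<bar>2\<bar>)"
    using g by (subst lborel_has_bochner_integral_real_affine_iff[symmetric]) auto
  moreover have "has_bochner_integral lborel (\<lambda>x. g1 (1 - (1/2 + 1 * x))) (J /\<^sub>R \<bar>1\<bar>)"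
    using J2 by (subst lborel_has_bochner_integral_real_affine_iff[symmetric, where f="\<lambda>x. g1 (1 - x)"]) auto
  from has_bochner_integral_add[OF J this]
  have "has_bochner_integral lborel (\<lambda>x. g1 x + g1 (1/2 - x)) (J + J)" by simp
  moreover have "g (2 * x) = g1 x + g1 (1/2 - x)" for x
  proof (cases "0 < x \<and> x < 1/2")
    case True
    have "sin (pi * (2 * x)) = 2 * sin (pi * x) * cos (pi * x)"
      using sin_double[of "pi * x"] by (simp add: mult.left_commute)
    moreover have "sin (pi * (1/2 - x)) = cos (pi * x)"
      using sin_cos_eq[of "pi/2 - pi * x"] by (simp add: algebra_simps)
    moreover have "sin (pi * x) > 0" using True by (intro sin_gt_zero) auto
    moreover have "cos (pi * x) > 0" using True by (intro cos_gt_zero) auto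
    ultimately have "L (2 * x) = L x + L (1/2 - x)"
      using ln_mult[of "2 * sin (pi * x)" "2 * cos (pi * x)"] by (simp add: L_def mult_ac)
    then show ?thesis using True by (auto simp: g_def g1_def indicator_def)
  qed (auto simp: g_def g1_def indicator_def)
  ultimately have "(J + J) /\<^sub>R 2 = J + J"
    by (auto simp: has_bochner_integral_iff)
  then have "J = 0" by (simp add: field_simps)
  then show ?thesis using g by (simp add: g_def[abs_def] L_def)
qed

section \<open>One-dimensional Euclidean spaces\<close>

lemma lborel_eq_distr_scaleR_basis:
  fixes b :: "'a::euclidean_space"
  assumes b: "Basis = {b}"
  shows "(lborel :: 'a measure) = distr lborel borel (\<lambda>x. x *\<^sub>R b)"
proof (rule lborel_eqI)
  fix l u :: 'a assume le: "\<And>c. c \<in> Basis \<Longrightarrow> l \<bullet> c \<le> u \<bullet> c"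
  have bb: "b \<bullet> b = 1" using b inner_same_Basis by blast
  have "(\<lambda>x. x *\<^sub>R b) -` box l u = {l \<bullet> b <..< u \<bullet> b}" by (auto simp: box_def b bb)
  then show "emeasure (distr lborel borel (\<lambda>x. x *\<^sub>R b)) (box l u) = (\<Prod>c\<in>Basis. (u - l) \<bullet> c)"
    using le[of b] by (subst emeasure_distr) (auto simp: inner_diff_left b)
qed simp

text \<open>
  The exceptional set \<open>N\<close> absorbs points such as \<open>h = 0\<close> or \<open>2\<alpha> \<in> \<int>\<close>, where the values of the integrand are
  not computed; as it is countable, the measurability of \<open>F\<close> comes with the conclusion.
\<close>

lemma has_bochner_integral_one_dim:
  fixes F :: "'a::euclidean_space \<Rightarrow> 'b::{banach, second_countable_topology}" and b :: 'a
  assumes b: "Basis = {b}" and f: "has_bochner_integral lborel f I"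
    and N: "countable N" and eq: "\<And>x. x \<notin> N \<Longrightarrow> F (x *\<^sub>R b) = f x"
  shows "has_bochner_integral lborel F I"
proof -
  have bb: "b \<bullet> b = 1" using b inner_same_Basis by blast
  have rep: "(h \<bullet> b) *\<^sub>R b = h" for h using euclidean_representation[of h] unfolding b by simp
  have fm [measurable]: "f \<in> borel_measurable borel" using f by (auto simp: has_bochner_integral_iff)
  have "has_bochner_integral (distr lborel borel (\<lambda>x. x *\<^sub>R b)) (\<lambda>h. f (h \<bullet> b)) I"
    by (rule has_bochner_integral_distr) (use f bb in auto)
  then have g: "has_bochner_integral lborel (\<lambda>h. f (h \<bullet> b)) I"
    using lborel_eq_distr_scaleR_basis[OF b] by simp
  let ?X = "(\<lambda>x. x *\<^sub>R b) ` N"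
  have X: "countable ?X" using N by simp
  have Fg: "f (h \<bullet> b) = F h" if "h \<notin> ?X" for h
    using eq[of "h \<bullet> b"] rep[of h] that by (metis imageI)
  have "integrable lborel F \<longleftrightarrow> integrable lborel (\<lambda>h. f (h \<bullet> b))"
    by (rule integrable_discrete_difference[OF X]) (use Fg in \<open>auto simp: eq_commute\<close>)
  moreover have "integral\<^sup>L lborel F = (LINT h|lborel. f (h \<bullet> b))"
    by (rule integral_discrete_difference[OF X]) (use Fg in \<open>auto simp: eq_commute\<close>)
  ultimately show ?thesis using g by (simp add: has_bochner_integral_iff)
qed

section \<open>Twisted eigenfunctions on a circle\<close>

lemma first_order_ode:
  fixes g :: "'a::euclidean_space \<Rightarrow> complex" and b :: 'a
  assumes b: "Basis = {b}" and g: "smooth g" and ode: "\<And>x. dir_deriv b g x = c * g x"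
  shows "g x = g 0 * exp (c * of_real (x \<bullet> b))"
proof -
  have rep: "(x \<bullet> b) *\<^sub>R b = x" using euclidean_representation[of x] unfolding b by simp
  define u where "u t = g (t *\<^sub>R b) * exp (- (c * of_real t))" for t
  have "(u has_vector_derivative 0) (at t)" for t
  proof -
    have "((\<lambda>t. t *\<^sub>R b) has_derivative (\<lambda>k. k *\<^sub>R b)) (at t)" by (auto intro!: derivative_eq_intros)
    from has_derivative_compose[OF this has_derivative_dir_deriv[OF smooth_differentiable[OF g]]]
    have "((\<lambda>t. g (t *\<^sub>R b)) has_derivative (\<lambda>k. dir_deriv (k *\<^sub>R b) g (t *\<^sub>R b))) (at t)" .
    moreover have "dir_deriv (k *\<^sub>R b) g y = k *\<^sub>R (c * g y)" for k y
      using linear_scale[OF has_derivative_linear[OF has_derivative_dir_deriv[OF smooth_differentiable[OF g]]]] ode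
      by simp
    ultimately have 1: "((\<lambda>t. g (t *\<^sub>R b)) has_vector_derivative c * g (t *\<^sub>R b)) (at t)"
      by (simp add: has_vector_derivative_def)
    have "((\<lambda>t. - (c * complex_of_real t)) has_vector_derivative - (c * of_real 1)) (at t)"
      by (intro has_vector_derivative_minus has_vector_derivative_mult_right has_vector_derivative_of_real DERIV_ident)
    from field_vector_diff_chain_at[OF this DERIV_exp]
    have 2: "((\<lambda>t. exp (- (c * complex_of_real t))) has_vector_derivative - c * exp (- (c * of_real t))) (at t)"
      by (simp add: o_def)
    show ?thesis unfolding u_def using has_vector_derivative_mult[OF 1 2] by simp
  qed
  then obtain k where k: "\<And>t. u t = k"
    using has_vector_derivative_zero_constant[of UNIV u] by (auto simp: has_vector_derivative_at_within)
  have "g x = u (x \<bullet> b) * exp (c * of_real (x \<bullet> b))"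
    by (simp add: u_def rep mult.assoc exp_add[symmetric])
  also have "u (x \<bullet> b) = u 0" using k by simp
  finally show ?thesis by (simp add: u_def)
qed

lemma dir_deriv_translation:
  assumes f: "smooth f" and eq: "\<And>x. f (\<gamma> + x) = \<epsilon> * f x"
  shows "dir_deriv v f (\<gamma> + x) = \<epsilon> * dir_deriv v f x"
proof -
  have "((\<lambda>x. \<gamma> + x) has_derivative (\<lambda>v. v)) (at x)" by (auto intro!: derivative_eq_intros)
  from has_derivative_compose[OF this has_derivative_dir_deriv[OF smooth_differentiable[OF f]]]
  have "((\<lambda>x. \<epsilon> * f x) has_derivative (\<lambda>v. dir_deriv v f (\<gamma> + x))) (at x)" by (simp add: eq)
  then have "dir_deriv v (\<lambda>x. \<epsilon> * f x) x = dir_deriv v f (\<gamma> + x)" by (rule dir_deriv_eqI)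
  then show ?thesis by (simp add: dir_deriv_cmult[OF smooth_differentiable[OF f]])
qed

lemma exp_eq_character_iff:
  fixes z :: complex and l a :: real
  assumes l: "l \<noteq> 0"
  shows "exp (z * of_real l) = exp (2 * of_real pi * \<i> * of_real a) \<longleftrightarrow>
    (\<exists>\<nu>::int. z = 2 * of_real pi * \<i> * of_real ((of_int \<nu> + a) / l))"
proof -
  have "z * of_real l = 2 * of_real pi * \<i> * of_real a + of_real (2 * of_int \<nu> * pi) * \<i> \<longleftrightarrow>
    z = 2 * of_real pi * \<i> * of_real ((of_int \<nu> + a) / l)" for \<nu>
    using l by (simp add: field_simps)
  then show ?thesis unfolding exp_eq by simp
qed

text \<open>
  The generator is the element that the isomorphism sends to \<open>1\<close>.
\<close>

lemma infinite_cyclic_lattice: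
  fixes \<Gamma> :: "'a::euclidean_space set" and \<phi> :: "'a \<Rightarrow> int ^ 'n"
  assumes \<Gamma>: "discrete_cocompact_subgroup \<Gamma>" and i: "(UNIV :: 'n set) = {i}"
    and bij: "bij_betw \<phi> \<Gamma> UNIV"
    and hom: "\<And>x y. x \<in> \<Gamma> \<Longrightarrow> y \<in> \<Gamma> \<Longrightarrow> \<phi> (x + y) = \<phi> x + \<phi> y"
  obtains \<gamma> where "\<gamma> \<noteq> 0" "\<Gamma> = range (\<lambda>m::int. of_int m *\<^sub>R \<gamma>)"
    "\<And>m::int. \<phi> (of_int m *\<^sub>R \<gamma>) $ i = m"
proof -
  have zero: "0 \<in> \<Gamma>" and add: "\<And>x y. x \<in> \<Gamma> \<Longrightarrow> y \<in> \<Gamma> \<Longrightarrow> x + y \<in> \<Gamma>" and neg: "\<And>x. x \<in> \<Gamma> \<Longrightarrow> - x \<in> \<Gamma>"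
    using \<Gamma> by (auto simp: discrete_cocompact_subgroup_def)
  have all_i: "j = i" for j using i by auto
  obtain \<gamma> where \<gamma>: "\<gamma> \<in> \<Gamma>" "\<phi> \<gamma> = (\<chi> j. 1)" using bij unfolding bij_betw_def by (metis UNIV_I imageE)
  have \<phi>0: "\<phi> 0 = 0" using hom[OF zero zero] by simp
  have \<phi>neg: "\<phi> (- x) = - \<phi> x" if "x \<in> \<Gamma>" for x
    using hom[OF that neg[OF that]] \<phi>0 by (simp add: eq_neg_iff_add_eq_0 add.commute)
  have nat: "of_nat m *\<^sub>R \<gamma> \<in> \<Gamma> \<and> \<phi> (of_nat m *\<^sub>R \<gamma>) $ i = int m" for m
  proof (induction m)
    case 0
    then show ?case by (simp add: zero \<phi>0)
  next
    case (Suc m)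
    then show ?case using add[OF \<gamma>(1)] hom[OF \<gamma>(1)] \<gamma>(2) by (simp add: scaleR_left_distrib)
  qed
  have int: "of_int m *\<^sub>R \<gamma> \<in> \<Gamma> \<and> \<phi> (of_int m *\<^sub>R \<gamma>) $ i = m" for m
  proof (cases m rule: int_cases2)
    case (nonneg k)
    then show ?thesis using nat[of k] by simp
  next
    case (nonpos k)
    then show ?thesis using nat[of k] neg[of "of_nat k *\<^sub>R \<gamma>"] \<phi>neg[of "of_nat k *\<^sub>R \<gamma>"] by simp
  qed
  have "\<Gamma> \<subseteq> range (\<lambda>m::int. of_int m *\<^sub>R \<gamma>)"
  proof
    fix x assume x: "x \<in> \<Gamma>"
    have "\<phi> x = \<phi> (of_int (\<phi> x $ i) *\<^sub>R \<gamma>)"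
      unfolding vec_eq_iff
    proof
      show "\<phi> x $ j = \<phi> (of_int (\<phi> x $ i) *\<^sub>R \<gamma>) $ j" for j
        using int[of "\<phi> x $ i"] all_i[of j] by simp
    qed
    then have "x = of_int (\<phi> x $ i) *\<^sub>R \<gamma>"
      using bij x int[of "\<phi> x $ i"] unfolding bij_betw_def inj_on_def by blast
    then show "x \<in> range (\<lambda>m::int. of_int m *\<^sub>R \<gamma>)" by blast
  qed
  moreover have "\<gamma> \<noteq> 0"
  proof
    assume "\<gamma> = 0"
    then show False using \<gamma>(2) \<phi>0 by (simp add: vec_eq_iff)
  qed
  ultimately show thesis using that[of \<gamma>] int by blast
qed

text \<open>
  The one-dimensional situation, with \<open>\<gamma>\<close> a generator of \<open>\<Gamma>\<close>.  The condition \<open>2\<alpha> \<notin> \<int>\<close> excludes the twists for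
  which \<open>\<nu> + \<alpha>\<close> and \<open>\<nu>' + \<alpha>\<close> can be opposite, that is, for which an eigenvalue can be double or zero.
\<close>

locale twisted_circle =
  fixes \<Gamma> :: "'a::euclidean_space set" and \<phi> :: "'a \<Rightarrow> int ^ 'n" and \<alpha> :: "real ^ 'n"
    and b \<gamma> :: 'a and i :: 'n
  assumes b: "Basis = {b}" and i: "(UNIV :: 'n set) = {i}"
    and \<gamma>: "\<gamma> \<noteq> 0" and \<Gamma>: "\<Gamma> = range (\<lambda>m::int. of_int m *\<^sub>R \<gamma>)"
    and \<phi>: "\<And>m::int. \<phi> (of_int m *\<^sub>R \<gamma>) $ i = m"
    and generic: "2 * \<alpha> $ i \<notin> \<int>"
begin

text \<open>
  The coordinate of the generator, which may be negative.
\<close>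

definition period :: real where "period = \<gamma> \<bullet> b"

definition frequency :: "int \<Rightarrow> real" where "frequency \<nu> = (of_int \<nu> + \<alpha> $ i) / period"

lemma b_inner: "b \<bullet> b = 1" using b inner_same_Basis by blast

lemma rep: "(x \<bullet> b) *\<^sub>R b = x"
  using euclidean_representation[of x] unfolding b by simp

lemma period_nonzero: "period \<noteq> 0"
  using rep[of \<gamma>] \<gamma> by (auto simp: period_def)

lemma char_\<Gamma>_eq: "char_\<Gamma> \<phi> \<alpha> (of_int m *\<^sub>R \<gamma>) = exp (2 * of_real pi * \<i> * of_real (\<alpha> $ i * of_int m))"
  unfolding char_\<Gamma>_def by (simp add: i \<phi>)

lemma frequency_square_inject:
  assumes "(frequency \<mu>)\<^sup>2 = (frequency \<nu>)\<^sup>2" shows "\<mu> = \<nu>"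
proof -
  have "frequency \<mu> = frequency \<nu> \<or> frequency \<mu> = - frequency \<nu>" using assms by (simp add: power2_eq_iff)
  moreover have "frequency \<mu> \<noteq> - frequency \<nu>"
  proof
    assume "frequency \<mu> = - frequency \<nu>"
    then have "frequency \<mu> * period = - (frequency \<nu> * period)" by simp
    then have "2 * \<alpha> $ i = of_int (- \<mu> - \<nu>)" using period_nonzero by (simp add: frequency_def)
    then show False using generic Ints_of_int by metis
  qed
  ultimately show ?thesis using period_nonzero by (simp add: frequency_def)
qed

lemma frequency_nonzero: "frequency \<nu> \<noteq> 0"
proof
  assume "frequency \<nu> = 0"
  then have "2 * \<alpha> $ i = of_int (- 2 * \<nu>)" using period_nonzero by (simp add: frequency_def)
  then show False using generic Ints_of_int by metis
qed

lemma char_G_in_twisted_eigenfunctions: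
  "char_G (frequency \<nu> *\<^sub>R b) \<in> twisted_eigenfunctions \<Gamma> \<phi> \<alpha> (4 * pi\<^sup>2 * (frequency \<nu>)\<^sup>2)"
proof -
  have "char_G (frequency \<nu> *\<^sub>R b) (of_int m *\<^sub>R \<gamma> + x) =
      char_\<Gamma> \<phi> \<alpha> (of_int m *\<^sub>R \<gamma>) * char_G (frequency \<nu> *\<^sub>R b) x" for m x
  proof -
    have "frequency \<nu> * (of_int m * (b \<bullet> \<gamma>)) = of_int (\<nu> * m) + \<alpha> $ i * of_int m"
      using period_nonzero by (simp add: frequency_def period_def inner_commute field_simps)
    then have "char_G (frequency \<nu> *\<^sub>R b) (of_int m *\<^sub>R \<gamma> + x) =
      exp (2 * of_real pi * \<i> * of_real (\<alpha> $ i * of_int m) + of_int (\<nu> * m) * (of_real (2 * pi) * \<i>)) * char_G (frequency \<nu> *\<^sub>R b) x"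
      unfolding char_G_def exp_add[symmetric]
      by (simp add: inner_add_right ring_distribs flip: of_real_mult of_real_add) (simp add: algebra_simps)
    moreover have "exp (of_int (\<nu> * m) * (of_real (2 * pi) * \<i>)) = 1"
      using exp_integer_2pi[of "of_int (\<nu> * m)"] by (simp add: mult_ac)
    ultimately show ?thesis by (simp add: char_\<Gamma>_eq exp_add)
  qed
  then show ?thesis
    unfolding twisted_eigenfunctions_def \<Gamma>
    by (simp add: smooth_char_G scalar_laplacian_char_G b_inner power2_eq_square)
qed

text \<open>
  With \<open>\<kappa>\<^sup>2 = \<mu>\<close> the equation \<open>f'' = - \<mu> f\<close> factors, and \<open>f' - i \<kappa> f\<close> and \<open>f' + i \<kappa> f\<close> are multiples
  of \<open>exp (- i \<kappa> t)\<close> and \<open>exp (i \<kappa> t)\<close>.  Both transform by the same character of \<open>\<Gamma>\<close>, so unless the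
  square of that character is trivial one of them vanishes and \<open>f\<close> is itself an exponential.
\<close>

lemma twisted_eigenfunction_cases:
  assumes f: "f \<in> twisted_eigenfunctions \<Gamma> \<phi> \<alpha> \<mu>" and nz: "f \<noteq> 0"
  obtains \<nu> where "\<mu> = 4 * pi\<^sup>2 * (frequency \<nu>)\<^sup>2" "f = fun_scale (f 0) (char_G (frequency \<nu> *\<^sub>R b))"
proof -
  define \<epsilon> where "\<epsilon> = exp (2 * of_real pi * \<i> * of_real (\<alpha> $ i))"
  define \<kappa> where "\<kappa> = csqrt (of_real \<mu>)"
  have \<kappa>: "\<kappa> * \<kappa> = of_real \<mu>" using power2_csqrt[of "of_real \<mu>"] by (simp add: \<kappa>_def power2_eq_square)
  have sm: "smooth f" and lap: "\<And>x. scalar_laplacian f x = of_real \<mu> * f x"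
    using f by (auto simp: twisted_eigenfunctions_def)
  have "\<gamma> \<in> \<Gamma>" unfolding \<Gamma> by (rule range_eqI[of _ _ 1]) simp
  then have eqf: "f (\<gamma> + x) = \<epsilon> * f x" for x
    using f char_\<Gamma>_eq[of 1] by (simp add: twisted_eigenfunctions_def \<epsilon>_def)
  define D where "D = dir_deriv b f"
  have smD: "smooth D" unfolding D_def by (rule smooth_dir_deriv[OF sm])
  have eqD: "D (\<gamma> + x) = \<epsilon> * D x" for x unfolding D_def by (rule dir_deriv_translation[OF sm eqf])
  have DD: "dir_deriv b D x = - (of_real \<mu> * f x)" for x
    using lap[of x] by (simp add: scalar_laplacian_def b D_def minus_equation_iff[of _ "_ * _"])
  have factor: "(\<forall>x. D x = c * f x) \<or> exp (- c * of_real period) = \<epsilon>" if c: "c * c = - of_real \<mu>" for c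
  proof -
    define g where "g x = D x + - c * f x" for x
    have sg: "smooth g" unfolding g_def by (intro smooth_add smooth_cmult sm smD)
    have "dir_deriv b g x = - c * g x" for x
    proof -
      have "dir_deriv b g x = dir_deriv b D x + - c * D x"
        unfolding g_def dir_deriv_add[OF smooth_differentiable[OF smD] smooth_differentiable[OF smooth_cmult[OF sm]]]
          dir_deriv_cmult[OF smooth_differentiable[OF sm]] by (simp add: D_def)
      also have "\<dots> = (c * c) * f x - c * D x" by (simp add: DD c)
      finally show ?thesis by (simp add: g_def algebra_simps)
    qed
    then have g: "g x = g 0 * exp (- c * of_real (x \<bullet> b))" for x by (rule first_order_ode[OF b sg])
    show ?thesis
    proof (cases "g 0 = 0")
      case True
      then have "g x = 0" for x using g[of x] by simp
      then show ?thesis by (simp add: g_def)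
    next
      case False
      have "g (\<gamma> + 0) = \<epsilon> * g 0" unfolding g_def eqf eqD by (simp add: algebra_simps)
      then have "g 0 * exp (- c * of_real period) = g 0 * \<epsilon>" using g[of \<gamma>] by (simp add: period_def mult.commute)
      then show ?thesis using False by simp
    qed
  qed
  have "\<epsilon> * \<epsilon> \<noteq> 1"
  proof
    assume "\<epsilon> * \<epsilon> = 1"
    moreover have "complex_of_real (2 * \<alpha> $ i) = of_real (\<alpha> $ i) + of_real (\<alpha> $ i)" by simp
    ultimately have "exp (2 * of_real pi * \<i> * of_real (2 * \<alpha> $ i)) = 1"
      by (simp only: \<epsilon>_def exp_add distrib_left)
    moreover have "2 * of_real pi * \<i> * of_real (2 * \<alpha> $ i) = of_real (2 * \<alpha> $ i) * (2 * of_real pi * \<i>)"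
      by (simp only: mult_ac)
    ultimately have "exp (of_real (2 * \<alpha> $ i) * (2 * of_real pi * \<i>)) = 1" by (simp only:)
    then have "2 * \<alpha> $ i \<in> \<int>"
      by (auto simp: exp_eq_1 Ints_def)
    then show False using generic by simp
  qed
  moreover have "exp (- (\<i> * \<kappa>) * of_real period) * exp (- (- (\<i> * \<kappa>)) * of_real period) = 1"
    by (simp add: exp_add[symmetric])
  moreover have sq: "\<i> * \<kappa> * (\<i> * \<kappa>) = - of_real \<mu>" "- (\<i> * \<kappa>) * - (\<i> * \<kappa>) = - of_real \<mu>"
    using \<kappa> by (simp_all add: mult.assoc mult.left_commute[of \<kappa>])
  ultimately have "(\<forall>x. D x = \<i> * \<kappa> * f x) \<or> (\<forall>x. D x = - (\<i> * \<kappa>) * f x)"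
    using factor[OF sq(1)] factor[OF sq(2)] by metis
  then obtain c where c: "c * c = - of_real \<mu>" "\<And>x. D x = c * f x"
    using sq by blast
  have fx: "f x = f 0 * exp (c * of_real (x \<bullet> b))" for x
    by (rule first_order_ode[OF b sm c(2)[unfolded D_def]])
  have "f 0 \<noteq> 0"
  proof
    assume "f 0 = 0"
    then have "f x = 0" for x by (subst fx) simp
    then show False using nz by (auto simp: fun_eq_iff)
  qed
  moreover have "f 0 * exp (c * of_real period) = f 0 * \<epsilon>" using fx[of \<gamma>] eqf[of 0] by (simp add: period_def mult.commute)
  ultimately have "exp (c * of_real period) = \<epsilon>" by simp
  then obtain \<nu> where \<nu>: "c = 2 * of_real pi * \<i> * of_real (frequency \<nu>)"
    unfolding \<epsilon>_def exp_eq_character_iff[OF period_nonzero] frequency_def by blast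
  have "complex_of_real \<mu> = - (c * c)" using c(1) by simp
  also have "\<dots> = of_real (4 * pi\<^sup>2 * (frequency \<nu>)\<^sup>2)" by (simp add: \<nu> power2_eq_square)
  finally have "\<mu> = 4 * pi\<^sup>2 * (frequency \<nu>)\<^sup>2" using of_real_eq_iff by blast
  moreover have "f = fun_scale (f 0) (char_G (frequency \<nu> *\<^sub>R b))"
    by (rule ext, subst fx) (simp add: fun_scale_def char_G_def \<nu> inner_commute mult.assoc)
  ultimately show thesis by (rule that)
qed

lemma dim_twisted_eigenfunctions:
  "func.dim (twisted_eigenfunctions \<Gamma> \<phi> \<alpha> (4 * pi\<^sup>2 * (frequency \<nu>)\<^sup>2)) = 1"
proof (rule func.dim_unique)
  let ?e = "char_G (frequency \<nu> *\<^sub>R b)"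
  have e0: "?e \<noteq> 0" by (auto simp: fun_eq_iff char_G_def)
  show "{?e} \<subseteq> twisted_eigenfunctions \<Gamma> \<phi> \<alpha> (4 * pi\<^sup>2 * (frequency \<nu>)\<^sup>2)"
    using char_G_in_twisted_eigenfunctions by blast
  show "func.independent {?e}" using e0 by simp
  show "twisted_eigenfunctions \<Gamma> \<phi> \<alpha> (4 * pi\<^sup>2 * (frequency \<nu>)\<^sup>2) \<subseteq> func.span {?e}"
  proof
    fix f assume f: "f \<in> twisted_eigenfunctions \<Gamma> \<phi> \<alpha> (4 * pi\<^sup>2 * (frequency \<nu>)\<^sup>2)"
    show "f \<in> func.span {?e}"
    proof (cases "f = 0")
      case True
      then show ?thesis by (metis func.span_zero)
    next
      case False
      then obtain \<nu>' where \<nu>': "4 * pi\<^sup>2 * (frequency \<nu>)\<^sup>2 = 4 * pi\<^sup>2 * (frequency \<nu>')\<^sup>2"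
        "f = fun_scale (f 0) (char_G (frequency \<nu>' *\<^sub>R b))"
        using twisted_eigenfunction_cases[OF f] by blast
      then have "\<nu>' = \<nu>" using frequency_square_inject[of \<nu> \<nu>'] by simp
      then show ?thesis using \<nu>'(2) func.span_scale[OF func.span_base[of ?e "{?e}"], of "f 0"] by simp
    qed
  qed
qed simp

text \<open>
  The spectrum is indexed injectively by \<open>\<nu> \<in> \<int>\<close> with multiplicities \<open>1\<close>, so the sum over eigenvalues is a sum
  over the shifted integers.
\<close>

lemma function_zeta_eq:
  assumes a: "0 < \<alpha> $ i" "\<alpha> $ i < 1" and s: "Re s > 1/2"
  shows "function_zeta \<Gamma> \<phi> \<alpha> s = pow_term (4 * pi\<^sup>2 / period\<^sup>2) s * lattice_zeta (\<alpha> $ i) (2 * s)"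
proof -
  let ?\<mu> = "\<lambda>\<nu>. 4 * pi\<^sup>2 * (frequency \<nu>)\<^sup>2" and ?C = "4 * pi\<^sup>2 / period\<^sup>2"
  have spec: "{\<mu>. \<exists>f\<in>twisted_eigenfunctions \<Gamma> \<phi> \<alpha> \<mu>. f \<noteq> 0} - {0} = range ?\<mu>"
  proof (intro subset_antisym subsetI)
    fix \<mu> assume "\<mu> \<in> {\<mu>. \<exists>f\<in>twisted_eigenfunctions \<Gamma> \<phi> \<alpha> \<mu>. f \<noteq> 0} - {0}"
    then obtain f where "f \<in> twisted_eigenfunctions \<Gamma> \<phi> \<alpha> \<mu>" "f \<noteq> 0" by blast
    then obtain \<nu> where "\<mu> = ?\<mu> \<nu>" by (rule twisted_eigenfunction_cases)
    then show "\<mu> \<in> range ?\<mu>" by blast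
  next
    fix \<mu> assume "\<mu> \<in> range ?\<mu>"
    then obtain \<nu> where \<nu>: "\<mu> = ?\<mu> \<nu>" by blast
    have "char_G (frequency \<nu> *\<^sub>R b) \<noteq> 0" by (auto simp: fun_eq_iff char_G_def)
    then show "\<mu> \<in> {\<mu>. \<exists>f\<in>twisted_eigenfunctions \<Gamma> \<phi> \<alpha> \<mu>. f \<noteq> 0} - {0}"
      using char_G_in_twisted_eigenfunctions[of \<nu>] frequency_nonzero[of \<nu>] by (auto simp: \<nu>)
  qed
  have inj: "inj ?\<mu>" using frequency_square_inject by (auto intro!: injI)
  have single: "of_nat (func.dim (twisted_eigenfunctions \<Gamma> \<phi> \<alpha> (?\<mu> \<nu>))) * complex_of_real (?\<mu> \<nu>) powr (- s) =
      pow_term ?C s * pow_term \<bar>of_int \<nu> + \<alpha> $ i\<bar> (2 * s)" for \<nu>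
  proof -
    have nz: "of_int \<nu> + \<alpha> $ i \<noteq> 0" using frequency_nonzero[of \<nu>] by (auto simp: frequency_def)
    have "?\<mu> \<nu> = ?C * (of_int \<nu> + \<alpha> $ i)\<^sup>2" by (simp add: frequency_def power_divide)
    then have "pow_term (?\<mu> \<nu>) s = pow_term ?C s * pow_term ((of_int \<nu> + \<alpha> $ i)\<^sup>2) s"
      using nz period_nonzero pow_term_mult[of ?C "(of_int \<nu> + \<alpha> $ i)\<^sup>2" s] by simp
    moreover have "?\<mu> \<nu> > 0" using frequency_nonzero[of \<nu>] by simp
    then have "complex_of_real (?\<mu> \<nu>) powr (- s) = pow_term (?\<mu> \<nu>) s" by (simp only: pow_term_eq_powr)
    ultimately show ?thesis by (simp only: dim_twisted_eigenfunctions of_nat_1 mult_1 pow_term_square[OF nz])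
  qed
  have "((\<lambda>\<nu>::int. pow_term \<bar>of_int \<nu> + \<alpha> $ i\<bar> (2 * s)) has_sum lattice_zeta (\<alpha> $ i) (2 * s)) UNIV"
    using s by (intro lattice_zeta_has_sum a) simp
  then have "(\<Sum>\<^sub>\<infinity>\<nu>::int. pow_term ?C s * pow_term \<bar>of_int \<nu> + \<alpha> $ i\<bar> (2 * s)) = pow_term ?C s * lattice_zeta (\<alpha> $ i) (2 * s)"
    by (simp add: infsum_cmult_right' infsumI)
  then show ?thesis
    unfolding function_zeta_def spec infsum_reindex[OF inj] o_def single .
qed

text \<open>
  As the lattice zeta function vanishes at \<open>0\<close>, the factor \<open>(4\<pi>\<^sup>2/l\<^sup>2)\<^sup>-\<^sup>s\<close> does not contribute to the derivative.
\<close>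

lemma analytic_torsion_circle:
  assumes a: "0 < \<alpha> $ i" "\<alpha> $ i < 1"
  shows "analytic_torsion \<Gamma> \<phi> \<alpha> = of_real (2 * ln (2 * sin (pi * \<alpha> $ i)))"
proof -
  let ?C = "4 * pi\<^sup>2 / period\<^sup>2"
  define g where "g s = pow_term ?C s * lattice_zeta (\<alpha> $ i) (2 * s)" for s
  have "is_continuation (function_zeta \<Gamma> \<phi> \<alpha>) g"
    unfolding is_continuation_def
  proof (intro conjI exI[of _ "1/2"] allI impI)
    have "(\<lambda>s. lattice_zeta (\<alpha> $ i) (2 * s)) meromorphic_on {s. Re s \<ge> 0}"
      by (rule meromorphic_on_compose[OF lattice_zeta_meromorphic]) (use a in \<open>auto intro!: analytic_intros\<close>)
    then show "g meromorphic_on {s. Re s \<ge> 0}"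
      unfolding g_def by (intro meromorphic_intros analytic_on_imp_meromorphic_on[OF pow_term_analytic])
    have "(lattice_zeta (\<alpha> $ i) \<circ> (\<lambda>s. 2 * s)) analytic_on {0}"
      by (rule analytic_on_compose) (use a lattice_zeta_analytic_0 in \<open>auto intro!: analytic_intros\<close>)
    then show "g analytic_on {0}"
      unfolding g_def by (intro analytic_intros pow_term_analytic) (simp add: o_def)
    show "g s = function_zeta \<Gamma> \<phi> \<alpha> s" if "Re s > 1/2" for s
      using function_zeta_eq[OF a that] by (simp add: g_def)
  qed
  then have "deriv (continuation (function_zeta \<Gamma> \<phi> \<alpha>)) 0 = deriv g 0" by (rule deriv_continuation)
  also have "(g has_field_derivative - of_real (2 * ln (2 * sin (pi * \<alpha> $ i)))) (at 0)"
  proof -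
    have "((\<lambda>s. 2 * s) has_field_derivative 2) (at (0::complex))" by (auto intro!: derivative_eq_intros)
    moreover have "(lattice_zeta (\<alpha> $ i) has_field_derivative - of_real (ln (2 * sin (pi * \<alpha> $ i)))) (at (2 * 0))"
      using lattice_zeta_has_derivative_0[OF a] by simp
    ultimately have l: "((\<lambda>s. lattice_zeta (\<alpha> $ i) (2 * s)) has_field_derivative - of_real (ln (2 * sin (pi * \<alpha> $ i))) * 2) (at 0)"
      by (intro DERIV_chain2)
    have "(pow_term ?C has_field_derivative - (of_real (ln ?C) * pow_term ?C 0) * 1) (at 0)"
      by (rule has_field_derivative_pow_term[OF DERIV_ident])
    from DERIV_mult[OF this l]
    have "(g has_field_derivative - of_real (ln (2 * sin (pi * \<alpha> $ i))) * 2) (at 0)"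
      by (simp add: g_def[abs_def] lattice_zeta_0)
    then show ?thesis by (simp only: of_real_mult of_real_numeral mult_minus_left mult.commute[of 2])
  qed
  then have "deriv g 0 = - of_real (2 * ln (2 * sin (pi * \<alpha> $ i)))" by (rule DERIV_imp_deriv)
  finally have "deriv (continuation (function_zeta \<Gamma> \<phi> \<alpha>)) 0 = - of_real (2 * ln (2 * sin (pi * \<alpha> $ i)))" .
  moreover have "degree_weight (DIM('a)) = -1" by (simp add: b degree_weight)
  ultimately show ?thesis by (simp only: analytic_torsion_eq minus_mult_minus mult_1)
qed

end

section \<open>The two torsions\<close>

lemma one_dim_basis:
  assumes "DIM('a::euclidean_space) = 1" obtains b :: "'a::euclidean_space" where "Basis = {b}"
  using assms card_1_singletonE[of "Basis :: 'a set"] by metis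

text \<open>
  On the line spanned by \<open>b\<close> the complement of \<open>dual_G0\<close> is \<open>\<bar>x\<bar> > r\<close>, and the integrand is even.
\<close>

lemma local_t_integral:
  fixes b :: "'a::euclidean_space"
  assumes b: "Basis = {b}" and r: "r > 0" and s: "Re s > 1/2"
  shows "(LINT h:(UNIV - dual_G0 (4 * pi\<^sup>2 * r\<^sup>2) :: 'a set)|lborel. local_t s h) =
    - 2 * of_real r * pow_term (4 * pi\<^sup>2) s * pow_term r (2 * s) / (2 * s - 1)"
proof -
  have bb: "b \<bullet> b = 1" using b inner_same_Basis by blast
  let ?I = "of_real r * pow_term r (2 * s) / (2 * s - 1)"
  have "has_bochner_integral lborel (\<lambda>x. indicator {r<..} x *\<^sub>R pow_term x (2 * s)) ?I"
    using s by (intro has_bochner_integral_pow_term_tail r) simp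
  then have "has_bochner_integral lborel (\<lambda>x. indicator {r<..} \<bar>x\<bar> *\<^sub>R pow_term \<bar>x\<bar> (2 * s)) (?I + ?I)"
    by (rule has_bochner_integral_even_extension) (use r in auto)
  then have f: "has_bochner_integral lborel
      (\<lambda>x. - pow_term (4 * pi\<^sup>2) s * (indicator {r<..} \<bar>x\<bar> *\<^sub>R pow_term \<bar>x\<bar> (2 * s))) (- pow_term (4 * pi\<^sup>2) s * (?I + ?I))"
    by (intro has_bochner_integral_mult_right)
  have G: "x *\<^sub>R b \<in> UNIV - dual_G0 (4 * pi\<^sup>2 * r\<^sup>2) \<longleftrightarrow> r < \<bar>x\<bar>" for x
    using r power_mono_iff[of r "\<bar>x\<bar>" 2] abs_le_square_iff[of x r]
    by (auto simp: dual_G0_eq bb not_le power2_eq_square[symmetric])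
  have "has_bochner_integral lborel
      (\<lambda>h. indicator (UNIV - dual_G0 (4 * pi\<^sup>2 * r\<^sup>2) :: 'a set) h *\<^sub>R local_t s h) (- pow_term (4 * pi\<^sup>2) s * (?I + ?I))"
  proof (rule has_bochner_integral_one_dim[OF b f, of "{}"])
    fix x :: real
    show "indicator (UNIV - dual_G0 (4 * pi\<^sup>2 * r\<^sup>2)) (x *\<^sub>R b) *\<^sub>R local_t s (x *\<^sub>R b) =
        - pow_term (4 * pi\<^sup>2) s * (indicator {r<..} \<bar>x\<bar> *\<^sub>R pow_term \<bar>x\<bar> (2 * s))"
    proof (cases "r < \<bar>x\<bar>")
      case True
      then have x: "x \<noteq> 0" using r by auto
      then have "x *\<^sub>R b \<noteq> 0" using bb by auto
      moreover have "pow_term (4 * pi\<^sup>2 * x\<^sup>2) s = pow_term (4 * pi\<^sup>2) s * pow_term \<bar>x\<bar> (2 * s)"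
        using x by (simp add: pow_term_mult pow_term_square)
      ultimately show ?thesis using True G[of x]
        by (simp add: local_t_eq bb b degree_weight power2_eq_square[symmetric])
    next
      case False
      then show ?thesis using G[of x] by simp
    qed
  qed simp
  then show ?thesis by (simp add: has_bochner_integral_iff set_lebesgue_integral_def)
qed

lemma local_torsion_integral:
  fixes b :: "'a::euclidean_space"
  assumes b: "Basis = {b}" and r: "r > 0"
  shows "(LINT h:(dual_G0 (4 * pi\<^sup>2 * r\<^sup>2) :: 'a set)|lborel. local_torsion h) =
    of_real (2 * r * ln (4 * pi\<^sup>2) + 4 * r * ln r - 4 * r)"
proof -
  have bb: "b \<bullet> b = 1" using b inner_same_Basis by blast
  define C where "C = ln (4 * pi\<^sup>2)"
  have "has_bochner_integral lborel (indicator {0<..r}) (measure lborel {0<..r})"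
    by (rule has_bochner_integral_real_indicator) (use r in auto)
  then have "has_bochner_integral lborel (indicator {0<..r}) r" using r by simp
  then have "has_bochner_integral lborel (\<lambda>x. C * indicator {0<..r} x + 2 * (indicator {0<..r} x * ln x))
      (C * r + 2 * (r * ln r - r))"
    by (intro has_bochner_integral_add has_bochner_integral_mult_right has_bochner_integral_ln r)
  then have "has_bochner_integral lborel (\<lambda>x. C * indicator {0<..r} \<bar>x\<bar> + 2 * (indicator {0<..r} \<bar>x\<bar> * ln \<bar>x\<bar>))
      ((C * r + 2 * (r * ln r - r)) + (C * r + 2 * (r * ln r - r)))"
    by (rule has_bochner_integral_even_extension) auto
  from has_bochner_integral_of_real[OF this]
  have f: "has_bochner_integral lborel
      (\<lambda>x. complex_of_real (C * indicator {0<..r} \<bar>x\<bar> + 2 * (indicator {0<..r} \<bar>x\<bar> * ln \<bar>x\<bar>)))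
      (of_real ((C * r + 2 * (r * ln r - r)) + (C * r + 2 * (r * ln r - r))))" .
  have G: "x *\<^sub>R b \<in> dual_G0 (4 * pi\<^sup>2 * r\<^sup>2) \<longleftrightarrow> \<bar>x\<bar> \<le> r" for x
    using r abs_le_square_iff[of x r]
    by (auto simp: dual_G0_eq bb not_le power2_eq_square[symmetric])
  have "has_bochner_integral lborel
      (\<lambda>h. indicator (dual_G0 (4 * pi\<^sup>2 * r\<^sup>2) :: 'a set) h *\<^sub>R local_torsion h)
      (of_real ((C * r + 2 * (r * ln r - r)) + (C * r + 2 * (r * ln r - r))))"
  proof (rule has_bochner_integral_one_dim[OF b f, of "{0}"])
    fix x :: real assume "x \<notin> {0}"
    then have x: "x \<noteq> 0" by simp
    then have "x *\<^sub>R b \<noteq> 0" using bb by auto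
    moreover have "ln (4 * pi\<^sup>2 * x\<^sup>2) = C + 2 * ln \<bar>x\<bar>"
      using x ln_realpow[of "\<bar>x\<bar>" 2] by (simp add: ln_mult C_def)
    ultimately show "indicator (dual_G0 (4 * pi\<^sup>2 * r\<^sup>2)) (x *\<^sub>R b) *\<^sub>R local_torsion (x *\<^sub>R b) =
        complex_of_real (C * indicator {0<..r} \<bar>x\<bar> + 2 * (indicator {0<..r} \<bar>x\<bar> * ln \<bar>x\<bar>))"
      using x G[of x] by (simp add: local_torsion_eq bb b degree_weight power2_eq_square[symmetric] indicator_def)
  qed simp
  moreover have "(C * r + 2 * (r * ln r - r)) + (C * r + 2 * (r * ln r - r)) = 2 * r * C + 4 * r * ln r - 4 * r"
    by (simp add: algebra_simps)
  ultimately show ?thesis by (simp add: has_bochner_integral_iff set_lebesgue_integral_def C_def)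
qed

lemma relative_torsion_eq_0:
  assumes K: "K > 0"
  shows "relative_torsion TYPE('a::euclidean_space) K = 0"
proof (cases "DIM('a) = 1")
  case False
  have t: "local_t s h = 0" for s and h :: 'a using False by (simp add: local_t_eq degree_weight)
  have "is_continuation (\<lambda>s. 0) (\<lambda>s. 0)" by (auto simp: is_continuation_def)
  from deriv_continuation[OF this] show ?thesis
    by (simp add: relative_torsion_def local_torsion_def t set_lebesgue_integral_def)
next
  case True
  then obtain b :: 'a where b: "Basis = {b}" by (rule one_dim_basis)
  define r where "r = sqrt K / (2 * pi)"
  have r: "r > 0" using K by (simp add: r_def)
  have K_eq: "K = 4 * pi\<^sup>2 * r\<^sup>2" using K by (simp add: r_def power_divide power_mult_distrib)
  define N where "N s = - 2 * of_real r * pow_term (4 * pi\<^sup>2) s * pow_term r (2 * s)" for s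
  define g where "g s = N s / (2 * s - 1)" for s
  have pa: "(\<lambda>s. pow_term r (2 * s)) analytic_on S" for S
    unfolding pow_term_def by (intro analytic_intros)
  have Na: "N analytic_on S" for S
    unfolding N_def by (intro analytic_intros pow_term_analytic pa)
  have "is_continuation (\<lambda>s. LINT h:(UNIV - dual_G0 K :: 'a set)|lborel. local_t s h) g"
    unfolding is_continuation_def
  proof (intro conjI exI[of _ "1/2"] allI impI)
    show "g meromorphic_on {s. Re s \<ge> 0}"
      unfolding g_def by (intro meromorphic_intros analytic_on_imp_meromorphic_on[OF Na])
    show "g analytic_on {0}" unfolding g_def by (intro analytic_intros Na) auto
    show "g s = (LINT h:(UNIV - dual_G0 K :: 'a set)|lborel. local_t s h)" if "Re s > 1/2" for s
      using local_t_integral[OF b r that] by (simp add: g_def N_def K_eq)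
  qed
  then have "deriv (continuation (\<lambda>s. LINT h:(UNIV - dual_G0 K :: 'a set)|lborel. local_t s h)) 0 = deriv g 0"
    by (rule deriv_continuation)
  also have "(g has_field_derivative - of_real (2 * r * ln (4 * pi\<^sup>2) + 4 * r * ln r - 4 * r)) (at 0)"
    unfolding g_def N_def
    by (rule derivative_eq_intros refl | simp)+
  then have "deriv g 0 = - of_real (2 * r * ln (4 * pi\<^sup>2) + 4 * r * ln r - 4 * r)" by (rule DERIV_imp_deriv)
  finally show ?thesis
    unfolding relative_torsion_def using local_torsion_integral[OF b r] by (simp add: K_eq)
qed

theorem proposition4p0p0p1:
  fixes \<Gamma> :: "'a::euclidean_space set" and \<phi> :: "'a \<Rightarrow> int ^ 'n" and K :: real
  assumes "discrete_cocompact_subgroup \<Gamma>"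
    and "CARD('n) = DIM('a)"
    and "bij_betw \<phi> \<Gamma> UNIV"
    and "\<And>x y. x \<in> \<Gamma> \<Longrightarrow> y \<in> \<Gamma> \<Longrightarrow> \<phi> (x + y) = \<phi> x + \<phi> y"
    and "K > 0"
  shows "set_integrable lborel (cbox 0 1) (analytic_torsion \<Gamma> \<phi>) \<and>
         relative_torsion TYPE('a) K = (LINT \<alpha>:cbox 0 1|lborel. analytic_torsion \<Gamma> \<phi> \<alpha>)"
proof -
  have "has_bochner_integral lborel (\<lambda>\<alpha>. indicator (cbox 0 1) \<alpha> *\<^sub>R analytic_torsion \<Gamma> \<phi> \<alpha>) 0"
  proof (cases "DIM('a) = 1")
    case False
    then show ?thesis by (simp add: analytic_torsion_eq degree_weight has_bochner_integral_zero)
  next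
    case True
    then obtain b :: 'a where b: "Basis = {b}" by (rule one_dim_basis)
    obtain i :: 'n where i: "(UNIV :: 'n set) = {i}"
      using assms(2) True card_1_singletonE[of "UNIV :: 'n set"] by metis
    obtain \<gamma> where \<gamma>: "\<gamma> \<noteq> 0" "\<Gamma> = range (\<lambda>m::int. of_int m *\<^sub>R \<gamma>)"
      "\<And>m::int. \<phi> (of_int m *\<^sub>R \<gamma>) $ i = m"
      using infinite_cyclic_lattice[OF assms(1) i assms(3,4)] by blast
    have all_i: "(\<forall>j. P j) \<longleftrightarrow> P i" for P :: "'n \<Rightarrow> bool" using i by (metis UNIV_I singletonD)
    have e: "(Basis :: (real ^ 'n) set) = {axis i 1}" by (simp add: Basis_vec_def i)
    have f: "has_bochner_integral lborel
        (\<lambda>x. complex_of_real (2 * (indicator {0<..<1} x * ln (2 * sin (pi * x))))) (of_real (2 * 0))"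
      by (intro has_bochner_integral_of_real has_bochner_integral_mult_right log_sine_integral)
    have "has_bochner_integral lborel (\<lambda>\<alpha>. indicator (cbox 0 1) \<alpha> *\<^sub>R analytic_torsion \<Gamma> \<phi> \<alpha>) (of_real (2 * 0))"
    \<comment> \<open>The formula for the torsion is used away from the three points of \<open>[0, 1]\<close> with \<open>2\<alpha> \<in> \<int>\<close>.\<close>
    proof (rule has_bochner_integral_one_dim[OF e f, of "{0, 1/2, 1}"])
      fix x :: real assume x: "x \<notin> {0, 1/2, 1}"
      have box: "x *\<^sub>R axis i 1 \<in> cbox (0 :: real ^ 'n) 1 \<longleftrightarrow> 0 \<le> x \<and> x \<le> 1"
        by (simp add: mem_box_cart all_i axis_def)
      show "indicator (cbox 0 1) (x *\<^sub>R axis i 1 :: real ^ 'n) *\<^sub>R analytic_torsion \<Gamma> \<phi> (x *\<^sub>R axis i 1) =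
          complex_of_real (2 * (indicator {0<..<1} x * ln (2 * sin (pi * x))))"
      proof (cases "0 \<le> x \<and> x \<le> 1")
        case True
        then have x01: "0 < x" "x < 1" using x by auto
        have comp: "(x *\<^sub>R axis i 1 :: real ^ 'n) $ i = x" by simp
        have "2 * x \<notin> \<int>"
        proof
          assume "2 * x \<in> \<int>"
          then obtain k :: int where k: "2 * x = of_int k" by (auto simp: Ints_def)
          then have "0 < k" "k < 2" using x01 by linarith+
          then have "k = 1" by simp
          then show False using k x by auto
        qed
        then interpret twisted_circle \<Gamma> \<phi> "x *\<^sub>R axis i 1" b \<gamma> i
          by unfold_locales (use b i \<gamma> comp in auto)
        show ?thesis
          using analytic_torsion_circle x01 comp box by (simp add: indicator_def)
      next
        case False
        then show ?thesis using box by auto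
      qed
    qed simp
    then show ?thesis by simp
  qed
  then show ?thesis
    using relative_torsion_eq_0[where 'a='a, OF assms(5)]
    by (simp add: has_bochner_integral_iff set_integrable_def set_lebesgue_integral_def)
qed

end
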